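(* Let $m$ be a positive integer with prime factorization $m=p_1^{k_1}\cdots p_h^{k_h}$, and let $S\colon\mathbb{Z}_m^{(\mathbb{Z})}\to\mathbb{Z}_m^{(\mathbb{Z})}$ be a finitary linear cellular automaton. For every $i\in\{1,\ldots,h\}$ let $L_i:=\mathbb{Z}_{p_i^{k_i}}^{(\mathbb{Z})}$ denote the direct factor of $\mathbb{Z}_m^{(\mathbb{Z})}\cong L_1\times\cdots\times L_h$. Then each $S^{(i)}:=S\restriction_{L_i}\colon L_i\to L_i$ is a finitary linear cellular automaton (on $\mathbb{Z}_{p_i^{k_i}}$) and $$h_{alg}(S)=\sum_{i=1}^h\deg(S^{(i)})\log p_i^{k_i}.$$
   Context: For a positive integer $q$, $\mathbb{Z}_q=\mathbb{Z}/q\mathbb{Z}$ and $\mathbb{Z}_q^{(\mathbb{Z})}$ is the (discrete) abelian group of finitely supported sequences $x=(x_n)_{n\in\mathbb{Z}}$ in $\mathbb{Z}_q$. A (one-dimensional) finitary linear cellular automaton on $\mathbb{Z}_q$ is a map $S_\lambda\colon\mathbb{Z}_q^{(\mathbb{Z})}\to\mathbb{Z}_q^{(\mathbb{Z})}$ of the form $(S_\lambda(x))_n=\sum_{i\in\mathbb{Z}}\lambda_ix_{n+i}$ for all $n\in\mathbb{Z}$, for some (unique) $\lambda\in\mathbb{Z}_q^{(\mathbb{Z})}$. The isomorphism $\mathbb{Z}_m^{(\mathbb{Z})}\cong L_1\times\cdots\times L_h$ is induced coordinatewise by the Chinese remainder isomorphism $\mathbb{Z}_m\cong\mathbb{Z}_{p_1^{k_1}}\times\cdots\times\mathbb{Z}_{p_h^{k_h}}$,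 $1\mapsto(1,\ldots,1)$; through it $L_i$ is regarded as a subgroup of $\mathbb{Z}_m^{(\mathbb{Z})}$, namely its $p_i$-primary component. Degree (for $q\geq 2$, $\lambda\in\mathbb{Z}_q^{(\mathbb{Z})}$): let $D=\{i\in\mathbb{Z}:\gcd(\lambda_i,q)=1\}$. If $D=\emptyset$, $\deg(S_\lambda)=0$. Otherwise let $l'=\min D$, $r'=\max D$, and put $\deg(S_\lambda)=-l'$ if $l'\leq r'\leq 0$; $\deg(S_\lambda)=r'$ if $0\leq l'\leq r'$; $\deg(S_\lambda)=r'-l'$ if $l'<0<r'$. Algebraic entropy: for an endomorphism $\phi$ of an abelian group $G$ and a non-empty finite $F\subseteq G$, let $\mathcal{T}_n(\phi,F)=F+\phi(F)+\cdots+\phi^{n-1}(F)$ and $H_{alg}(\phi,F)=\lim_{n\to\infty}\frac{\log|\mathcal{T}_n(\phi,F)|}{n}$ (the limit exists); then $h_{alg}(\phi)=\sup\{H_{alg}(\phi,F):F\subseteq G\text{ non-empty finite}\}$. *)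

theory Defs
  imports
    "HOL-Library.Extended_Real"
    "HOL-Number_Theory.Cong"
    "HOL-Computational_Algebra.Primes"
    "HOL-Algebra.Product_Groups"
begin

section \<open>Finitary linear cellular automata\<close>

text \<open>Groups are written multiplicatively, so \<open>\<one>\<close> is the zero sequence of the
  discrete group of finitely supported sequences in \<open>\<int>/q\<int>\<close>; residues
  are represented by the integers in \<open>{0..<q}\<close>.\<close>

definition fin_seq_group :: "nat \<Rightarrow> (int \<Rightarrow> int) monoid" where
  "fin_seq_group q = sum_group UNIV (\<lambda>_. integer_mod_group q)"

definition linear_CA :: "nat \<Rightarrow> (int \<Rightarrow> int) \<Rightarrow> (int \<Rightarrow> int) \<Rightarrow> (int \<Rightarrow> int)" where
  "linear_CA q c x = (\<lambda>n. (\<Sum>i | c i \<noteq> 0. c i * x (n + i)) mod int q)"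

text \<open>The type of \<open>S\<close> is larger than the group; only the values of \<open>S\<close> on the carrier
  matter, here and in all the notions below.\<close>

definition is_CA_with_coeffs :: "nat \<Rightarrow> ((int \<Rightarrow> int) \<Rightarrow> (int \<Rightarrow> int)) \<Rightarrow> (int \<Rightarrow> int) \<Rightarrow> bool" where
  "is_CA_with_coeffs q S c \<longleftrightarrow>
     c \<in> carrier (fin_seq_group q) \<and> (\<forall>x \<in> carrier (fin_seq_group q). S x = linear_CA q c x)"

definition finitary_linear_CA :: "nat \<Rightarrow> ((int \<Rightarrow> int) \<Rightarrow> (int \<Rightarrow> int)) \<Rightarrow> bool" where
  "finitary_linear_CA q S \<longleftrightarrow> (\<exists>c. is_CA_with_coeffs q S c)"

definition CA_coeffs :: "nat \<Rightarrow> ((int \<Rightarrow> int) \<Rightarrow> (int \<Rightarrow> int)) \<Rightarrow> (int \<Rightarrow> int)" where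
  "CA_coeffs q S = (THE c. is_CA_with_coeffs q S c)"

text \<open>Only meant for \<open>q \<ge> 2\<close>; then \<open>D\<close> is finite, since \<open>0\<close> is not coprime to \<open>q\<close>.\<close>

definition CA_degree :: "nat \<Rightarrow> ((int \<Rightarrow> int) \<Rightarrow> (int \<Rightarrow> int)) \<Rightarrow> int" where
  "CA_degree q S =
     (let D = {i. gcd (CA_coeffs q S i) (int q) = 1}; l = Min D; r = Max D in
      if D = {} then 0
      else if r \<le> 0 then - l
      else if 0 \<le> l then r
      else r - l)"


section \<open>Algebraic entropy\<close>

text \<open>\<open>trajectory G \<phi> F n\<close> is \<open>F + \<phi>(F) + \<dots> + \<phi>\<^sup>n\<^sup>-\<^sup>1(F)\<close>, in multiplicative notation; the empty
  product at \<open>n = 0\<close> is \<open>{\<one>}\<close>.\<close>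

primrec trajectory ::
    "('a, 'b) monoid_scheme \<Rightarrow> ('a \<Rightarrow> 'a) \<Rightarrow> 'a set \<Rightarrow> nat \<Rightarrow> 'a set" where
  "trajectory G \<phi> F 0 = {\<one>\<^bsub>G\<^esub>}"
| "trajectory G \<phi> F (Suc n) = trajectory G \<phi> F n <#>\<^bsub>G\<^esub> ((\<phi> ^^ n) ` F)"

definition alg_entropy_wrt ::
    "('a, 'b) monoid_scheme \<Rightarrow> ('a \<Rightarrow> 'a) \<Rightarrow> 'a set \<Rightarrow> real" where
  "alg_entropy_wrt G \<phi> F = lim (\<lambda>n. ln (real (card (trajectory G \<phi> F n))) / real n)"

definition alg_entropy :: "('a, 'b) monoid_scheme \<Rightarrow> ('a \<Rightarrow> 'a) \<Rightarrow> ereal" where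
  "alg_entropy G \<phi> =
     (SUP F \<in> {F. F \<subseteq> carrier G \<and> F \<noteq> {} \<and> finite F}. ereal (alg_entropy_wrt G \<phi> F))"


section \<open>The Chinese remainder decomposition\<close>

text \<open>Throughout, \<open>q 1, \<dots>, q h\<close> are pairwise coprime and positive (in the application they are
  prime powers).\<close>

definition crt_map :: "nat \<Rightarrow> (nat \<Rightarrow> nat) \<Rightarrow> (int \<Rightarrow> int) \<Rightarrow> (nat \<Rightarrow> int \<Rightarrow> int)" where
  "crt_map h q x = (\<lambda>i\<in>{1..h}. \<lambda>n. x n mod int (q i))"

text \<open>The embedding of the \<open>i\<close>-th factor: put \<open>y\<close> in position \<open>i\<close> and zero in the other
  positions, and apply the inverse of the Chinese remainder isomorphism.\<close>

definition factor_embedding :: "nat \<Rightarrow> (nat \<Rightarrow> nat) \<Rightarrow> nat \<Rightarrow> (int \<Rightarrow> int) \<Rightarrow> (int \<Rightarrow> int)" where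
  "factor_embedding h q i y =
     inv_into (carrier (fin_seq_group (\<Prod>j=1..h. q j))) (crt_map h q)
       (\<lambda>j\<in>{1..h}. if j = i then y else \<one>\<^bsub>fin_seq_group (q j)\<^esub>)"

definition factor_subgroup :: "nat \<Rightarrow> (nat \<Rightarrow> nat) \<Rightarrow> nat \<Rightarrow> (int \<Rightarrow> int) set" where
  "factor_subgroup h q i = factor_embedding h q i ` carrier (fin_seq_group (q i))"

text \<open>The restriction of \<open>S\<close> to the \<open>i\<close>-th factor, read as a self-map of
  \<open>fin_seq_group (q i)\<close>; meaningful when \<open>S\<close> maps \<open>factor_subgroup h q i\<close> into itself.\<close>

definition factor_restriction ::
    "nat \<Rightarrow> (nat \<Rightarrow> nat) \<Rightarrow> nat \<Rightarrow> ((int \<Rightarrow> int) \<Rightarrow> (int \<Rightarrow> int)) \<Rightarrow> ((int \<Rightarrow> int) \<Rightarrow> (int \<Rightarrow> int))" where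
  "factor_restriction h q i S y =
     inv_into (carrier (fin_seq_group (q i))) (factor_embedding h q i) (S (factor_embedding h q i y))"


section \<open>Consistency of the definitions\<close>

lemma carrier_fin_seq_group:
  assumes "q > 0"
  shows "carrier (fin_seq_group q) = {x. (\<forall>n. 0 \<le> x n \<and> x n < int q) \<and> finite {n. x n \<noteq> 0}}"
  using assms unfolding fin_seq_group_def
  by (auto simp: carrier_sum_group carrier_integer_mod_group PiE_iff)

lemma one_fin_seq_group: "\<one>\<^bsub>fin_seq_group q\<^esub> = (\<lambda>_. 0)"
  by (simp add: fin_seq_group_def restrict_UNIV)

lemma mult_fin_seq_group: "x \<otimes>\<^bsub>fin_seq_group q\<^esub> y = (\<lambda>n. (x n + y n) mod int q)"
  by (simp add: fin_seq_group_def restrict_UNIV)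

lemma pow_fin_seq_group:
  assumes "q > 0" "x \<in> carrier (fin_seq_group q)"
  shows "x [^]\<^bsub>fin_seq_group q\<^esub> (k::nat) = (\<lambda>n. (int k * x n) mod int q)"
proof (induction k)
  case 0
  then show ?case by (simp add: one_fin_seq_group nat_pow_0)
next
  case (Suc k)
  then show ?case
    by (simp add: mult_fin_seq_group mod_simps algebra_simps)
qed

lemma comm_group_fin_seq_group: "comm_group (fin_seq_group q)"
proof (rule group.group_comm_groupI)
  show "group (fin_seq_group q)"
    by (simp add: fin_seq_group_def)
  show "\<And>x y. x \<otimes>\<^bsub>fin_seq_group q\<^esub> y = y \<otimes>\<^bsub>fin_seq_group q\<^esub> x"
    by (simp add: mult_fin_seq_group add.commute)
qed

lemma is_CA_with_coeffs_unique:
  assumes "q > 0" "is_CA_with_coeffs q S c" "is_CA_with_coeffs q S d"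
  shows "c = d"
proof (cases "q = 1")
  case True
  then have "c n = 0" "d n = 0" for n
    using assms by (auto simp: is_CA_with_coeffs_def carrier_fin_seq_group) (metis less_le_not_le zless_imp_add1_zle add_0 linorder_not_less order_antisym_conv)+
  then show ?thesis by auto
next
  case False
  then have q: "q > 1" using assms by simp
  define e :: "int \<Rightarrow> int" where "e = (\<lambda>n. if n = 0 then 1 else 0)"
  have e: "e \<in> carrier (fin_seq_group q)"
    using q by (auto simp: carrier_fin_seq_group e_def)
  have *: "linear_CA q b e (-j) = b j" if "b \<in> carrier (fin_seq_group q)" for b j
  proof -
    have fin: "finite {i. b i \<noteq> 0}" and bd: "0 \<le> b j" "b j < int q"
      using that q by (auto simp: carrier_fin_seq_group)
    have "(\<Sum>i | b i \<noteq> 0. b i * e (-j + i)) = (\<Sum>i | b i \<noteq> 0. if i = j then b j else 0)"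
      by (intro sum.cong) (auto simp: e_def)
    also have "\<dots> = b j" using fin by (simp add: sum.delta)
    finally show ?thesis using bd by (simp add: linear_CA_def)
  qed
  show ?thesis
  proof
    fix j
    have "linear_CA q c e = linear_CA q d e"
      using assms(2,3) e by (simp add: is_CA_with_coeffs_def)
    with *[of c j] *[of d j] assms(2,3) show "c j = d j"
      by (simp add: is_CA_with_coeffs_def)
  qed
qed

locale coprime_moduli =
  fixes h :: nat and q :: "nat \<Rightarrow> nat"
  assumes q_pos: "i \<in> {1..h} \<Longrightarrow> q i > 0"
    and q_coprime: "i \<in> {1..h} \<Longrightarrow> j \<in> {1..h} \<Longrightarrow> i \<noteq> j \<Longrightarrow> coprime (q i) (q j)"
begin

abbreviation "M \<equiv> \<Prod>j=1..h. q j"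

lemma M_pos: "M > 0"
  using q_pos by (auto intro!: prod_pos)

lemma cong_M_iff:
  fixes a b :: int
  shows "[a = b] (mod int M) \<longleftrightarrow> (\<forall>i\<in>{1..h}. [a = b] (mod int (q i)))"
proof
  assume *: "\<forall>i\<in>{1..h}. [a = b] (mod int (q i))"
  have "(\<Prod>j\<in>A. int (q j)) dvd a - b" if "A \<subseteq> {1..h}" for A
    using finite_subset[OF that finite_atLeastAtMost] that
  proof (induction rule: finite_induct)
    case (insert i A)
    have "coprime (int (q i)) (\<Prod>j\<in>A. int (q j))"
      using insert q_coprime by (intro prod_coprime_right) (auto simp: subset_iff)
    then show ?case
      using insert * by (auto simp: cong_iff_dvd_diff intro!: divides_mult)
  qed simp
  then show "[a = b] (mod int M)" by (simp add: cong_iff_dvd_diff)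
next
  assume *: "[a = b] (mod int M)"
  show "\<forall>i\<in>{1..h}. [a = b] (mod int (q i))"
    by (intro ballI cong_dvd_modulus[OF *]) (auto intro!: dvd_prodI)
qed

lemma crt_solution:
  fixes u :: "nat \<Rightarrow> int"
  obtains z :: int where "0 \<le> z" "z < int M" "\<And>i. i \<in> {1..h} \<Longrightarrow> [z = u i] (mod int (q i))"
proof -
  have "\<exists>x::nat. \<forall>i\<in>{1..h}. [x = nat (u i mod int (q i))] (mod q i)"
    using q_coprime by (intro chinese_remainder_nat) auto
  then obtain x where x: "\<And>i. i\<in>{1..h} \<Longrightarrow> [x = nat (u i mod int (q i))] (mod q i)" by blast
  have "[int x mod int M = u i] (mod int (q i))" if i: "i \<in> {1..h}" for i
  proof -
    have "[int x mod int M = int x] (mod int M)" by (simp add: cong_def)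
    then have "[int x mod int M = int x] (mod int (q i))" using cong_M_iff i by blast
    also have "[int x = int (nat (u i mod int (q i)))] (mod int (q i))"
      using x[OF i] cong_int_iff by blast
    also have "int (nat (u i mod int (q i))) = u i mod int (q i)" using q_pos[OF i] by simp
    also have "[u i mod int (q i) = u i] (mod int (q i))" by (simp add: cong_def)
    finally show ?thesis .
  qed
  moreover have "0 < int M" using M_pos unfolding of_nat_0_less_iff .
  then have "0 \<le> int x mod int M" "int x mod int M < int M"
    by (rule pos_mod_sign, rule pos_mod_bound)
  ultimately show ?thesis using that[of "int x mod int M"] by blast
qed

theorem crt_map_iso:
  "crt_map h q \<in> iso (fin_seq_group M) (product_group {1..h} (\<lambda>i. fin_seq_group (q i)))"
proof (rule isoI)
  note cM = carrier_fin_seq_group[OF M_pos]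
  note cq = carrier_fin_seq_group[OF q_pos]
  show "crt_map h q \<in> hom (fin_seq_group M) (product_group {1..h} (\<lambda>i. fin_seq_group (q i)))"
  proof (rule homI)
    fix x assume x: "x \<in> carrier (fin_seq_group M)"
    have "finite {n. x n mod int (q i) \<noteq> 0}" for i
      by (rule finite_subset[of _ "{n. x n \<noteq> 0}"]) (use x[unfolded cM] in auto)
    then show "crt_map h q x \<in> carrier (product_group {1..h} (\<lambda>i. fin_seq_group (q i)))"
      using q_pos by (auto simp: crt_map_def cq)
  next
    fix x y :: "int \<Rightarrow> int"
    have "(x n + y n) mod int M mod int (q i) = (x n mod int (q i) + y n mod int (q i)) mod int (q i)"
      if "i \<in> {1..h}" for i n
    proof -
      have "[(x n + y n) mod int M = x n + y n] (mod int M)" by (simp add: cong_def)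
      then have "[(x n + y n) mod int M = x n + y n] (mod int (q i))" using cong_M_iff that by blast
      then show ?thesis by (simp add: cong_def mod_add_eq)
    qed
    then show "crt_map h q (x \<otimes>\<^bsub>fin_seq_group M\<^esub> y) =
        crt_map h q x \<otimes>\<^bsub>product_group {1..h} (\<lambda>i. fin_seq_group (q i))\<^esub> crt_map h q y"
      by (simp add: crt_map_def mult_fin_seq_group restrict_def fun_eq_iff)
  qed
  show "bij_betw (crt_map h q) (carrier (fin_seq_group M))
          (carrier (product_group {1..h} (\<lambda>i. fin_seq_group (q i))))"
  proof (rule bij_betw_imageI)
    show "inj_on (crt_map h q) (carrier (fin_seq_group M))"
    proof (rule inj_onI, rule ext)
      fix x y n
      assume x: "x \<in> carrier (fin_seq_group M)" and y: "y \<in> carrier (fin_seq_group M)"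
        and eq: "crt_map h q x = crt_map h q y"
      have "[x n = y n] (mod int (q i))" if "i \<in> {1..h}" for i
        using fun_cong[OF fun_cong[OF eq, of i], of n] that by (simp add: crt_map_def cong_def)
      then have "[x n = y n] (mod int M)" using cong_M_iff by blast
      then show "x n = y n" using x[unfolded cM] y[unfolded cM] by (simp add: cong_def)
    qed
    show "crt_map h q ` carrier (fin_seq_group M) =
        carrier (product_group {1..h} (\<lambda>i. fin_seq_group (q i)))" (is "?L = ?R")
    proof
      show "?L \<subseteq> ?R"
        using \<open>crt_map h q \<in> hom _ _\<close> by (auto simp: hom_def)
      show "?R \<subseteq> ?L"
      proof
        fix w assume w: "w \<in> ?R"
        then have wc: "w i \<in> carrier (fin_seq_group (q i))" if "i \<in> {1..h}" for i using that by auto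
        have "\<exists>z. 0 \<le> z \<and> z < int M \<and> (\<forall>i\<in>{1..h}. [z = w i n] (mod int (q i)))" for n
          by (rule crt_solution[of "\<lambda>i. w i n"]) blast
        then obtain x where x: "\<And>n. 0 \<le> x n" "\<And>n. x n < int M"
            "\<And>n i. i\<in>{1..h} \<Longrightarrow> [x n = w i n] (mod int (q i))" by metis
        have "x n = 0" if "\<forall>i\<in>{1..h}. w i n = 0" for n
        proof -
          have "[x n = 0] (mod int M)" unfolding cong_M_iff using x(3)[of _ n] that by simp
          then show ?thesis using x(1,2)[of n] by (simp add: cong_def)
        qed
        then have "{n. x n \<noteq> 0} \<subseteq> (\<Union>i\<in>{1..h}. {n. w i n \<noteq> 0})" by blast
        then have "finite {n. x n \<noteq> 0}"
          by (rule finite_subset) (use wc cq in auto)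
        then have "x \<in> carrier (fin_seq_group M)" unfolding cM using x by simp
        moreover have "crt_map h q x = w"
        proof
          fix i
          show "crt_map h q x i = w i"
          proof (cases "i \<in> {1..h}")
            case True
            have "x n mod int (q i) = w i n" for n
              using x(3)[OF True, of n] wc[OF True] cq[OF True] by (simp add: cong_def)
            then show ?thesis using True by (simp add: crt_map_def)
          next
            case False
            then show ?thesis using w by (auto simp: crt_map_def PiE_iff extensional_def)
          qed
        qed
        ultimately show "w \<in> ?L" by blast
      qed
    qed
  qed
qed

lemma crt_map_factor_embedding:
  assumes "i \<in> {1..h}" "y \<in> carrier (fin_seq_group (q i))"
  shows "factor_embedding h q i y \<in> carrier (fin_seq_group M)"
    and "crt_map h q (factor_embedding h q i y) = (\<lambda>j\<in>{1..h}. if j = i then y else (\<lambda>_. 0))"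
proof -
  have im: "crt_map h q ` carrier (fin_seq_group M) = carrier (product_group {1..h} (\<lambda>i. fin_seq_group (q i)))"
    using crt_map_iso by (auto simp: iso_def bij_betw_def)
  have "(\<lambda>j\<in>{1..h}. if j = i then y else (\<lambda>_. 0)) \<in> crt_map h q ` carrier (fin_seq_group M)"
    unfolding im using assms q_pos by (auto simp: carrier_fin_seq_group)
  then show "factor_embedding h q i y \<in> carrier (fin_seq_group M)"
    and "crt_map h q (factor_embedding h q i y) = (\<lambda>j\<in>{1..h}. if j = i then y else (\<lambda>_. 0))"
    unfolding factor_embedding_def one_fin_seq_group
    by (rule inv_into_into, rule f_inv_into_f)
qed

lemma inj_on_factor_embedding:
  assumes "i \<in> {1..h}"
  shows "inj_on (factor_embedding h q i) (carrier (fin_seq_group (q i)))"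
proof (rule inj_onI)
  fix x y assume "x \<in> carrier (fin_seq_group (q i))" "y \<in> carrier (fin_seq_group (q i))"
    "factor_embedding h q i x = factor_embedding h q i y"
  then have "(\<lambda>j\<in>{1..h}. if j = i then x else (\<lambda>_. 0)) i = (\<lambda>j\<in>{1..h}. if j = i then y else (\<lambda>_. 0)) i"
    using crt_map_factor_embedding(2)[OF assms] by metis
  then show "x = y" using assms by simp
qed

lemma factor_subgroup_eq:
  assumes i: "i \<in> {1..h}"
  shows "factor_subgroup h q i =
    {x \<in> carrier (fin_seq_group M). \<forall>j\<in>{1..h}. j \<noteq> i \<longrightarrow> (\<forall>n. int (q j) dvd x n)}" (is "_ = ?R")
proof
  show "factor_subgroup h q i \<subseteq> ?R"
  proof
    fix x assume "x \<in> factor_subgroup h q i"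
    then obtain y where y: "y \<in> carrier (fin_seq_group (q i))" "x = factor_embedding h q i y"
      by (auto simp: factor_subgroup_def)
    note * = crt_map_factor_embedding[OF i y(1), folded y(2)]
    have "int (q j) dvd x n" if "j \<in> {1..h}" "j \<noteq> i" for j n
      using fun_cong[OF fun_cong[OF *(2), of j], of n] that by (auto simp: crt_map_def)
    then show "x \<in> ?R" using *(1) by auto
  qed
  show "?R \<subseteq> factor_subgroup h q i"
  proof
    fix x assume x: "x \<in> ?R"
    define y where "y = crt_map h q x i"
    have inj: "inj_on (crt_map h q) (carrier (fin_seq_group M))"
      and mem: "crt_map h q x \<in> carrier (product_group {1..h} (\<lambda>i. fin_seq_group (q i)))"
      using crt_map_iso x by (auto simp: iso_def bij_betw_def)
    from mem i have y: "y \<in> carrier (fin_seq_group (q i))" by (auto simp: y_def)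
    have "crt_map h q x = (\<lambda>j\<in>{1..h}. if j = i then y else (\<lambda>_. 0))"
      using x by (auto simp: y_def crt_map_def restrict_def fun_eq_iff)
    then have "x = factor_embedding h q i y"
      using crt_map_factor_embedding[OF i y] x inj by (simp add: inj_on_def)
    then show "x \<in> factor_subgroup h q i" using y by (auto simp: factor_subgroup_def)
  qed
qed

end

text \<open>For the prime factorization, the \<open>i\<close>-th factor is the \<open>p i\<close>-primary component.\<close>

theorem factor_subgroup_primary:
  fixes h :: nat and p k :: "nat \<Rightarrow> nat"
  assumes p: "\<And>i. i \<in> {1..h} \<Longrightarrow> Factorial_Ring.prime (p i)" and inj: "inj_on p {1..h}"
    and i: "i \<in> {1..h}"
  defines "G \<equiv> fin_seq_group (\<Prod>j=1..h. p j ^ k j)"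
  shows "factor_subgroup h (\<lambda>i. p i ^ k i) i =
     {x \<in> carrier G. \<exists>e::nat. x [^]\<^bsub>G\<^esub> (p i ^ e) = \<one>\<^bsub>G\<^esub>}"
proof -
  interpret coprime_moduli h "\<lambda>i. p i ^ k i"
  proof
    show "p i ^ k i > 0" if "i \<in> {1..h}" for i
      using p[OF that] by (simp add: prime_gt_0_nat)
    show "coprime (p i ^ k i) (p j ^ k j)" if "i \<in> {1..h}" "j \<in> {1..h}" "i \<noteq> j" for i j
    proof -
      have "p i \<noteq> p j" using inj that by (auto dest: inj_onD)
      then have "coprime (p i) (p j)" using p that by (simp add: primes_coprime)
      then show ?thesis by simp
    qed
  qed
  have pow: "x [^]\<^bsub>G\<^esub> N = \<one>\<^bsub>G\<^esub> \<longleftrightarrow>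
      (\<forall>n. \<forall>j\<in>{1..h}. int (p j ^ k j) dvd int N * x n)" if "x \<in> carrier G" for x and N :: nat
    using cong_M_iff[of "int N * x n" 0 for n]  pow_fin_seq_group[OF M_pos that[unfolded G_def]]
    unfolding G_def by (simp add: one_fin_seq_group fun_eq_iff cong_0_iff mod_eq_0_iff_dvd)
  have "(\<forall>j\<in>{1..h}. j \<noteq> i \<longrightarrow> (\<forall>n. int (p j ^ k j) dvd x n)) \<longleftrightarrow>
        (\<exists>e::nat. \<forall>n. \<forall>j\<in>{1..h}. int (p j ^ k j) dvd int (p i ^ e) * x n)" for x :: "int \<Rightarrow> int"
  proof
    assume *: "\<forall>j\<in>{1..h}. j \<noteq> i \<longrightarrow> (\<forall>n. int (p j ^ k j) dvd x n)"
    have "\<forall>n. \<forall>j\<in>{1..h}. int (p j ^ k j) dvd int (p i ^ k i) * x n"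
    proof (intro allI ballI)
      fix n j assume "j \<in> {1..h}"
      then show "int (p j ^ k j) dvd int (p i ^ k i) * x n"
        using * by (cases "j = i") auto
    qed
    then show "\<exists>e::nat. \<forall>n. \<forall>j\<in>{1..h}. int (p j ^ k j) dvd int (p i ^ e) * x n" by blast
  next
    assume "\<exists>e::nat. \<forall>n. \<forall>j\<in>{1..h}. int (p j ^ k j) dvd int (p i ^ e) * x n"
    then obtain e where e: "\<And>n j. j\<in>{1..h} \<Longrightarrow> int (p j ^ k j) dvd int (p i ^ e) * x n" by blast
    show "\<forall>j\<in>{1..h}. j \<noteq> i \<longrightarrow> (\<forall>n. int (p j ^ k j) dvd x n)"
    proof (intro ballI impI allI)
      fix j n assume j: "j \<in> {1..h}" "j \<noteq> i"
      have "p i \<noteq> p j" using inj i j by (auto dest: inj_onD)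
      then have "coprime (p j) (p i)" using p i j by (simp add: primes_coprime)
      then have "coprime (int (p j ^ k j)) (int (p i ^ e))" unfolding coprime_int_iff by simp
      then show "int (p j ^ k j) dvd x n" using e[OF j(1)] coprime_dvd_mult_right_iff by blast
    qed
  qed
  then show ?thesis
    unfolding factor_subgroup_eq[OF i] G_def[symmetric] using pow by blast
qed

end

theory Submission
  imports Defs
begin

text \<open>
  Write \<open>S\<close> for the automaton on \<open>\<int>/M\<close>, with \<open>M\<close> the product of the prime powers
  \<open>q i = p i ^ k i\<close>, and let \<open>c\<close> be its coefficients. The coefficient at \<open>j\<close> translates a
  sequence by \<open>-j\<close>. Modulo \<open>p = p i\<close> only the coefficients prime to \<open>p\<close> survive, so \<open>S\<close> spreads
  supports by at most \<open>a i = max 0 (- min D)\<close> per step to the right and by at most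
  \<open>b i = max 0 (max D)\<close> to the left, where \<open>D\<close> is the set of positions of these coefficients
  (both speeds are zero if \<open>D\<close> is empty). The degree of the \<open>i\<close>-th restriction is precisely
  \<open>a i + b i\<close> (\<open>degree_speeds\<close>), and the formula says that the \<open>i\<close>-th component of a trajectory
  gains \<open>a i + b i\<close> free cells, each worth \<open>ln (q i)\<close>, per step. The limit that defines the
  entropy exists for every finite set by Fekete's lemma (\<open>entropy_limit\<close>). All estimates take
  place inside \<open>\<int>/M\<close>; the components enter only through divisibility by \<open>q i\<close>.

  Upper bound (\<open>trajectory_upper_bound\<close>). The coefficients divisible by \<open>p\<close> may reach beyond
  \<open>D\<close>, but every use of one of them contributes a factor \<open>p\<close>, so at most \<open>k i - 1\<close> of them can
  contribute modulo \<open>q i\<close>: whatever the number of steps, they extend the support by a constant.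
  The filtration \<open>decays\<close> records this trade-off between distance and divisibility. Hence the
  \<open>i\<close>-th component of an element of the \<open>n\<close>-th trajectory lives on an interval of
  \<open>n * (a i + b i)\<close> cells up to a constant, and such sequences are counted by the Chinese
  remainder theorem.

  Lower bound (\<open>trajectory_lower_bound\<close>). Let \<open>F\<close> consist of the sequences whose \<open>i\<close>-th
  component is supported on \<open>{0..<a i + b i}\<close>. Then all the sums
  \<open>g\<^sub>0 + S g\<^sub>1 + \<dots> + S\<^sup>n\<^sup>-\<^sup>1 g\<^sub>n\<^sub>-\<^sub>1\<close> with \<open>g\<^sub>j \<in> F\<close> are distinct. Modulo a prime this is the
  uniqueness of digits in an expansion to a polynomial base: in a direction of positive speed
  \<open>S\<close> moves the extreme nonzero entry by exactly that speed, so \<open>S\<close> of a nonzero tail of the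
  expansion cannot fit in the window of \<open>g\<^sub>0\<close>. Prime powers follow by dividing by \<open>p\<close>
  repeatedly. So the \<open>n\<close>-th trajectory has at least \<open>card F ^ n\<close> elements, which matches the
  upper bound.
\<close>

section \<open>Trajectories and the existence of the entropy limit\<close>

text \<open>Fekete's lemma: dividing \<open>n\<close> by a fixed \<open>N\<close> with remainder bounds \<open>a n / n\<close> by \<open>a N / N\<close> plus
  a term that tends to \<open>0\<close>, so the quotients converge to their infimum.\<close>

lemma subadditive_convergent:
  fixes a :: "nat \<Rightarrow> real"
  assumes sub: "\<And>m n. a (m + n) \<le> a m + a n" and nonneg: "\<And>n. 0 \<le> a n"
  shows "convergent (\<lambda>n. a n / real n)"
proof -
  define L where "L = (INF n\<in>{1..}. a n / real n)"
  have bdd: "bdd_below ((\<lambda>n. a n / real n) ` {1..})"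
    by (rule bdd_belowI2[of _ 0]) (simp add: nonneg)
  have mult: "a (j * N + r) \<le> real j * a N + a r" for j N r
  proof (induction j)
    case (Suc j)
    have "a (Suc j * N + r) \<le> a N + a (j * N + r)" using sub[of N "j * N + r"] by (simp add: add.assoc)
    then show ?case using Suc.IH by (simp add: algebra_simps)
  qed simp
  have "(\<lambda>n. a n / real n) \<longlonglongrightarrow> L"
  proof (rule LIMSEQ_I)
    fix e :: real assume e: "0 < e"
    then have "(INF n\<in>{1..}. a n / real n) < L + e / 2" by (simp add: L_def)
    then obtain N where N: "N \<ge> 1" "a N / real N < L + e / 2"
      using bdd by (subst (asm) cINF_less_iff) auto
    \<comment> \<open>a common bound for the values at all possible remainders\<close>
    define B where "B = (\<Sum>r<N. a r)"
    obtain n0 :: nat where n0: "2 * B / e < real n0" using reals_Archimedean2 by blast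
    have "norm (a n / real n - L) < e" if n: "n \<ge> Suc n0" for n
    proof -
      have npos: "0 < real n" using n by simp
      have "a (n mod N) \<le> B"
        unfolding B_def using N by (intro member_le_sum) (auto simp: nonneg)
      then have "a n \<le> real (n div N) * a N + B"
        using mult[of "n div N" N "n mod N"] by simp
      also have "real (n div N) * a N \<le> real n / real N * a N"
        by (intro mult_right_mono nonneg of_nat_div_le_of_nat)
      finally have "a n / real n \<le> (real n / real N * a N + B) / real n"
        using npos by (simp add: divide_right_mono)
      also have "\<dots> = a N / real N + B / real n" using npos by (simp add: field_simps)
      also have "B / real n < e / 2"
      proof -
        have "2 * B / e < real n" using n0 n by linarith
        then show ?thesis using e npos by (simp add: field_simps)
      qed
      finally have "a n / real n < L + e" using N(2) by linarith
      moreover have "L \<le> a n / real n"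
        unfolding L_def using n by (intro cINF_lower bdd) auto
      ultimately show ?thesis by simp
    qed
    then show "\<exists>n0. \<forall>n\<ge>n0. norm (a n / real n - L) < e" by blast
  qed
  then show ?thesis by (rule convergentI)
qed

lemma card_set_mult_le:
  assumes "finite A" "finite B"
  shows "finite (A <#>\<^bsub>G\<^esub> B)" and "card (A <#>\<^bsub>G\<^esub> B) \<le> card A * card B"
proof -
  have eq: "A <#>\<^bsub>G\<^esub> B = (\<lambda>(a, b). a \<otimes>\<^bsub>G\<^esub> b) ` (A \<times> B)"
    by (auto simp: set_mult_def)
  show "finite (A <#>\<^bsub>G\<^esub> B)" unfolding eq using assms by simp
  show "card (A <#>\<^bsub>G\<^esub> B) \<le> card A * card B"
    unfolding eq using assms by (metis card_cartesian_product card_image_le finite_cartesian_product)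
qed

lemma funpow_hom:
  assumes "\<phi> \<in> hom G G"
  shows "(\<phi> ^^ n) \<in> hom G G"
proof (induction n)
  case 0
  then show ?case by (simp add: hom_def)
next
  case (Suc n)
  then show ?case using assms by (auto simp: hom_def Pi_iff)
qed

context group
begin

lemma trajectory_subset_carrier:
  assumes "\<phi> \<in> hom G G" "F \<subseteq> carrier G"
  shows "trajectory G \<phi> F n \<subseteq> carrier G"
proof (induction n)
  case (Suc n)
  have "(\<phi> ^^ n) ` F \<subseteq> carrier G" using funpow_hom[OF assms(1), of n] assms(2) by (auto simp: hom_def)
  then show ?case using Suc by (simp add: set_mult_closed)
qed simp

lemma finite_trajectory: "finite F \<Longrightarrow> finite (trajectory G \<phi> F n)"
  by (induction n) (auto intro: card_set_mult_le(1))

lemma trajectory_nonempty: "F \<noteq> {} \<Longrightarrow> trajectory G \<phi> F n \<noteq> {}"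
  by (induction n) (auto simp: set_mult_def)

lemma trajectory_add:
  assumes phi: "\<phi> \<in> hom G G" and F: "F \<subseteq> carrier G"
  shows "trajectory G \<phi> F (a + b) = trajectory G \<phi> F a <#> (\<phi> ^^ a) ` trajectory G \<phi> F b"
proof (induction b)
  case 0
  have "(\<phi> ^^ a) \<one> = \<one>"
    using hom_one[OF funpow_hom[OF phi]] is_group by blast
  moreover have "x \<otimes> \<one> = x" if "x \<in> trajectory G \<phi> F a" for x
    using trajectory_subset_carrier[OF assms, of a] that by auto
  ultimately show ?case
    by (auto simp: set_mult_def)
next
  case (Suc b)
  have hom: "(\<phi> ^^ n) ` X \<subseteq> carrier G" if "X \<subseteq> carrier G" for n X
    using funpow_hom[OF phi, of n] that by (auto simp: hom_def)
  note T = trajectory_subset_carrier[OF assms]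
  have "trajectory G \<phi> F (a + Suc b) =
      trajectory G \<phi> F a <#> (\<phi> ^^ a) ` trajectory G \<phi> F b <#> (\<phi> ^^ a) ` ((\<phi> ^^ b) ` F)"
    by (simp add: Suc funpow_add image_comp)
  also have "\<dots> = trajectory G \<phi> F a <#> ((\<phi> ^^ a) ` trajectory G \<phi> F b <#> (\<phi> ^^ a) ` ((\<phi> ^^ b) ` F))"
    by (intro set_mult_assoc T hom F)
  also have "(\<phi> ^^ a) ` trajectory G \<phi> F b <#> (\<phi> ^^ a) ` ((\<phi> ^^ b) ` F) =
      (\<phi> ^^ a) ` (trajectory G \<phi> F b <#> (\<phi> ^^ b) ` F)"
    using set_mult_hom[OF funpow_hom[OF phi, of a] T[of b] hom[OF F, of b]] by simp
  finally show ?case by simp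
qed

text \<open>By \<open>trajectory_add\<close> the sizes of the trajectories are submultiplicative, so Fekete's lemma
  applies to their logarithms. This turns the value of \<open>lim\<close> into an actual limit.\<close>

lemma entropy_limit:
  assumes phi: "\<phi> \<in> hom G G" and F: "F \<subseteq> carrier G" "F \<noteq> {}" "finite F"
  shows "(\<lambda>n. ln (real (card (trajectory G \<phi> F n))) / real n) \<longlonglongrightarrow> alg_entropy_wrt G \<phi> F"
proof -
  define N where "N n = card (trajectory G \<phi> F n)" for n
  have pos: "N n > 0" for n
    using trajectory_nonempty finite_trajectory F by (simp add: N_def card_gt_0_iff)
  have "ln (real (N (a + b))) \<le> ln (real (N a)) + ln (real (N b))" for a b
  proof -
    have "N (a + b) \<le> N a * card ((\<phi> ^^ a) ` trajectory G \<phi> F b)"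
      unfolding N_def trajectory_add[OF phi F(1)]
      by (intro card_set_mult_le finite_imageI finite_trajectory F)
    also have "\<dots> \<le> N a * N b"
      unfolding N_def by (intro mult_left_mono card_image_le finite_trajectory F) simp
    finally have "real (N (a + b)) \<le> real (N a) * real (N b)"
      by (metis of_nat_le_iff of_nat_mult)
    then have "ln (real (N (a + b))) \<le> ln (real (N a) * real (N b))"
      using pos by simp
    then show ?thesis using pos by (simp add: ln_mult)
  qed
  moreover have "0 \<le> ln (real (N n))" for n using pos[of n] by simp
  ultimately have "convergent (\<lambda>n. ln (real (N n)) / real n)" by (rule subadditive_convergent)
  then show ?thesis unfolding alg_entropy_wrt_def N_def by (simp add: convergent_LIMSEQ_iff)
qed

end

section \<open>The automaton over the integers\<close>

text \<open>The formula of the automaton before reduction. Computing with integers makes it linear on the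
  nose and lets one coefficient sequence serve all the moduli at once.\<close>

definition act :: "(int \<Rightarrow> int) \<Rightarrow> (int \<Rightarrow> int) \<Rightarrow> int \<Rightarrow> int" where
  "act c x n = (\<Sum>i | c i \<noteq> 0. c i * x (n + i))"

lemma linear_CA_eq_act: "linear_CA q c x = (\<lambda>n. act c x n mod int q)"
  by (simp add: linear_CA_def act_def)

lemma act_eq_sum:
  assumes "finite A" "\<And>i. c i \<noteq> 0 \<Longrightarrow> i \<in> A"
  shows "act c x n = (\<Sum>i\<in>A. c i * x (n + i))"
  unfolding act_def using assms by (intro sum.mono_neutral_left) auto

lemma act_add: "act c (\<lambda>n. x n + y n) n = act c x n + act c y n"
  by (simp add: act_def sum.distrib algebra_simps)

lemma act_diff: "act c (\<lambda>n. x n - y n) n = act c x n - act c y n"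
  by (simp add: act_def sum_subtractf algebra_simps)

lemma act_scale: "act c (\<lambda>n. a * x n) n = a * act c x n"
  by (simp add: act_def sum_distrib_left algebra_simps)

lemma act_cong:
  assumes "\<And>n. [x n = y n] (mod q)"
  shows "[act c x n = act c y n] (mod q)"
  unfolding act_def by (intro cong_sum cong_mult cong_refl assms)

lemma act_cong_coeffs:
  assumes "finite {i. c i \<noteq> 0}" "finite {i. d i \<noteq> 0}" "\<And>i. [c i = d i] (mod q)"
  shows "[act c x n = act d x n] (mod q)"
proof -
  let ?A = "{i. c i \<noteq> 0} \<union> {i. d i \<noteq> 0}"
  have "act c x n = (\<Sum>i\<in>?A. c i * x (n + i))" "act d x n = (\<Sum>i\<in>?A. d i * x (n + i))"
    using assms by (auto intro!: act_eq_sum)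
  then show ?thesis using assms(3) by (auto intro!: cong_sum cong_mult)
qed

lemma act_dvd:
  assumes "\<And>i. c i \<noteq> 0 \<Longrightarrow> a dvd c i * x (n + i)"
  shows "a dvd act c x n"
  unfolding act_def by (intro dvd_sum) (use assms in auto)

lemma act_in_carrier:
  assumes q: "q > 0" and "c \<in> carrier (fin_seq_group q)" "x \<in> carrier (fin_seq_group q)"
  shows "linear_CA q c x \<in> carrier (fin_seq_group q)"
proof -
  have fin: "finite {i. c i \<noteq> 0}" "finite {n. x n \<noteq> 0}"
    using assms by (auto simp: carrier_fin_seq_group)
  have "{n. act c x n \<noteq> 0} \<subseteq> (\<lambda>(i, j). j - i) ` ({i. c i \<noteq> 0} \<times> {n. x n \<noteq> 0})"
  proof
    fix n assume "n \<in> {n. act c x n \<noteq> 0}"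
    then obtain i where "c i \<noteq> 0" "x (n + i) \<noteq> 0"
      unfolding act_def by (auto elim: sum.not_neutral_contains_not_neutral)
    then show "n \<in> (\<lambda>(i, j). j - i) ` ({i. c i \<noteq> 0} \<times> {n. x n \<noteq> 0})"
      by (intro image_eqI[of _ _ "(i, n + i)"]) auto
  qed
  then have "finite {n. act c x n \<noteq> 0}" by (rule finite_subset) (use fin in auto)
  then have "finite {n. act c x n mod int q \<noteq> 0}" by (rule rev_finite_subset) auto
  then show ?thesis using q by (auto simp: carrier_fin_seq_group linear_CA_eq_act)
qed

lemma CA_hom:
  assumes q: "q > 0" and S: "is_CA_with_coeffs q S c"
  shows "S \<in> hom (fin_seq_group q) (fin_seq_group q)"
proof (rule homI)
  have c: "c \<in> carrier (fin_seq_group q)"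
    and eq: "\<And>x. x \<in> carrier (fin_seq_group q) \<Longrightarrow> S x = linear_CA q c x"
    using S by (auto simp: is_CA_with_coeffs_def)
  interpret comm_group "fin_seq_group q" by (rule comm_group_fin_seq_group)
  show "S x \<in> carrier (fin_seq_group q)" if "x \<in> carrier (fin_seq_group q)" for x
    using act_in_carrier[OF q c that] eq[OF that] by simp
  fix x y assume xy: "x \<in> carrier (fin_seq_group q)" "y \<in> carrier (fin_seq_group q)"
  have "[act c (\<lambda>n. (x n + y n) mod int q) n = act c x n + act c y n] (mod int q)" for n
    unfolding act_add[symmetric] by (rule act_cong) (simp add: cong_def)
  then show "S (x \<otimes>\<^bsub>fin_seq_group q\<^esub> y) = S x \<otimes>\<^bsub>fin_seq_group q\<^esub> S y"
    using eq[OF m_closed[OF xy]] xy by (simp add: eq linear_CA_eq_act mult_fin_seq_group cong_def mod_add_eq)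
qed

lemma CA_funpow_cong:
  assumes q: "q > 0" and S: "is_CA_with_coeffs q S c" and x: "x \<in> carrier (fin_seq_group q)"
  shows "[(S ^^ j) x n = (act c ^^ j) x n] (mod int q)"
proof (induction j arbitrary: n)
  case (Suc j)
  have "(S ^^ j) x \<in> carrier (fin_seq_group q)"
    using funpow_hom[OF CA_hom[OF q S], of j] x by (auto simp: hom_def)
  then have "(S ^^ Suc j) x n = act c ((S ^^ j) x) n mod int q"
    using S by (simp add: is_CA_with_coeffs_def linear_CA_eq_act)
  moreover have "[act c ((S ^^ j) x) n = act c ((act c ^^ j) x) n] (mod int q)"
    by (rule act_cong) (rule Suc.IH)
  ultimately show ?case by (simp add: cong_def)
qed simp

section \<open>Speed of propagation\<close>

text \<open>The sign \<open>\<sigma> \<in> {1, -1}\<close> chooses an end of the support modulo \<open>p\<close>, so that each argument about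
  extreme entries is made only once: \<open>b\<close> bounds the right end for \<open>\<sigma> = 1\<close> and the negated left
  end for \<open>\<sigma> = -1\<close>. Applied to coefficients the direction is reversed, since the coefficient at
  \<open>i\<close> translates by \<open>-i\<close>: the speed in direction \<open>\<sigma>\<close> is a bound \<open>\<rho>\<close> with \<open>reach_le p (- \<sigma>) c \<rho>\<close>.\<close>

definition reach_le :: "int \<Rightarrow> int \<Rightarrow> (int \<Rightarrow> int) \<Rightarrow> int \<Rightarrow> bool" where
  "reach_le p \<sigma> x b \<longleftrightarrow> (\<forall>n. \<not> p dvd x n \<longrightarrow> \<sigma> * n \<le> b)"

text \<open>Beyond \<open>U\<close>, in direction \<open>\<sigma>\<close>, the \<open>p\<close>-adic valuation grows by one for each further block of
  length \<open>K\<close>, up to valuation \<open>k\<close>. It is used with a \<open>K\<close> that bounds the translation by any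
  coefficient in direction \<open>\<sigma>\<close>.\<close>

definition decays :: "int \<Rightarrow> nat \<Rightarrow> int \<Rightarrow> int \<Rightarrow> (int \<Rightarrow> int) \<Rightarrow> int \<Rightarrow> bool" where
  "decays p k K \<sigma> x U \<longleftrightarrow> (\<forall>s<k. \<forall>n. \<sigma> * n > U + K * int s \<longrightarrow> p ^ Suc s dvd x n)"

text \<open>A unit coefficient moves by at most \<open>\<rho>\<close>, which is the shift of \<open>U\<close>. Any other coefficient may
  move by a whole further block of length \<open>K\<close>, where one power of \<open>p\<close> less is guaranteed, but it
  supplies that power itself.\<close>

lemma decays_act:
  assumes x: "decays p k K \<sigma> x U"
    and speed: "reach_le p (- \<sigma>) c \<rho>" and "0 \<le> \<rho>"
    and K: "\<And>i. c i \<noteq> 0 \<Longrightarrow> - \<sigma> * i \<le> K"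
  shows "decays p k K \<sigma> (act c x) (U + \<rho>)"
  unfolding decays_def
proof (intro allI impI)
  fix s n assume s: "s < k" and n: "\<sigma> * n > U + \<rho> + K * int s"
  show "p ^ Suc s dvd act c x n"
  proof (rule act_dvd)
    fix i assume i: "c i \<noteq> 0"
    show "p ^ Suc s dvd c i * x (n + i)"
    proof (cases "p dvd c i")
      case True
      have "p ^ s dvd x (n + i)"
      proof (cases s)
        case (Suc t)
        have "\<sigma> * (n + i) > U + K * int t"
          using n K[OF i] \<open>0 \<le> \<rho>\<close> Suc by (simp add: algebra_simps)
        then show ?thesis using x Suc s unfolding decays_def by auto
      qed simp
      then show ?thesis using True by (simp add: mult_dvd_mono)
    next
      case False
      then have "- \<sigma> * i \<le> \<rho>" using speed by (simp add: reach_le_def)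
      then have "\<sigma> * (n + i) > U + K * int s" using n by (simp add: algebra_simps)
      then show ?thesis using x s unfolding decays_def by auto
    qed
  qed
qed

lemma decays_add: "decays p k K \<sigma> x U \<Longrightarrow> decays p k K \<sigma> y U \<Longrightarrow> decays p k K \<sigma> (\<lambda>n. x n + y n) U"
  unfolding decays_def by (metis dvd_add)

lemma decays_mono: "decays p k K \<sigma> x U \<Longrightarrow> U \<le> V \<Longrightarrow> decays p k K \<sigma> x V"
  unfolding decays_def by (meson add_right_mono order.strict_trans1)

lemma decays_cong:
  assumes x: "decays p k K \<sigma> x U" and xy: "\<And>n. [x n = y n] (mod q)" and "p ^ k dvd q"
  shows "decays p k K \<sigma> y U"
  unfolding decays_def
proof (intro allI impI)
  fix s n assume s: "s < k" and n: "\<sigma> * n > U + K * int s"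
  have "p ^ Suc s dvd q" using assms(3) s by (meson Suc_leI dvd_trans le_imp_power_dvd)
  then have "[x n = y n] (mod p ^ Suc s)" using xy cong_dvd_modulus by blast
  then show "p ^ Suc s dvd y n" using x s n unfolding decays_def by (meson cong_dvd_iff)
qed

lemma decays_last:
  assumes "decays p k K \<sigma> x U" "0 \<le> K" "\<sigma> * n > U + K * int k"
  shows "p ^ k dvd x n"
proof (cases k)
  case (Suc s)
  have "K * int s \<le> K * int k" using assms(2) Suc by (simp add: mult_left_mono)
  then have "\<sigma> * n > U + K * int s" using assms(3) by linarith
  then show ?thesis using assms(1) Suc by (auto simp: decays_def)
qed simp

text \<open>The decay profile moves at the speed \<open>\<rho>\<close> of the unit coefficients alone; the other
  coefficients determine only its shape.\<close>

lemma decays_trajectory: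
  assumes q: "q > 0" and S: "is_CA_with_coeffs q S c" and pk: "p ^ k dvd int q"
    and speed: "reach_le p (- \<sigma>) c \<rho>" "0 \<le> \<rho>"
    and K: "0 \<le> K" "\<And>i. c i \<noteq> 0 \<Longrightarrow> - \<sigma> * i \<le> K"
    and F: "F \<subseteq> carrier (fin_seq_group q)" "\<And>f n. f \<in> F \<Longrightarrow> f n \<noteq> 0 \<Longrightarrow> \<sigma> * n \<le> U"
    and "0 \<le> U"
    and "x \<in> trajectory (fin_seq_group q) S F n"
  shows "decays p k K \<sigma> x (U + int n * \<rho>)"
  using assms(11)
proof (induction n arbitrary: x)
  case 0
  then show ?case by (simp add: decays_def one_fin_seq_group)
next
  case (Suc n)
  from Suc.prems obtain y f where y: "y \<in> trajectory (fin_seq_group q) S F n"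
    and f: "f \<in> F" and x: "x = (\<lambda>j. (y j + (S ^^ n) f j) mod int q)"
    by (auto simp: set_mult_def mult_fin_seq_group)
  have mono: "U + int n * \<rho> \<le> U + int (Suc n) * \<rho>" using speed(2) by (simp add: algebra_simps)
  have f0: "decays p k K \<sigma> f U"
    unfolding decays_def
  proof (intro allI impI)
    fix s i assume "\<sigma> * i > U + K * int s"
    moreover have "0 \<le> K * int s" using K(1) by simp
    ultimately have "f i = 0" using F(2)[OF f, of i] by linarith
    then show "p ^ Suc s dvd f i" by simp
  qed
  have "decays p k K \<sigma> ((act c ^^ j) f) (U + int j * \<rho>)" for j
  proof (induction j)
    case (Suc j)
    show ?case using decays_act[OF Suc.IH speed K(2)] by (simp add: algebra_simps)
  qed (use f0 in simp)
  then have "decays p k K \<sigma> ((S ^^ n) f) (U + int n * \<rho>)"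
    using f F(1) by (intro decays_cong[OF _ cong_sym[OF CA_funpow_cong[OF q S]] pk]) auto
  then have "decays p k K \<sigma> (\<lambda>j. y j + (S ^^ n) f j) (U + int n * \<rho>)"
    by (rule decays_add[OF Suc.IH[OF y]])
  then have "decays p k K \<sigma> x (U + int n * \<rho>)"
    by (rule decays_cong[OF _ _ pk]) (simp add: x cong_def)
  then show ?case by (rule decays_mono[OF _ mono])
qed

section \<open>Injectivity of Horner expansions\<close>

text \<open>The sum of the terms \<open>(act c ^^ j) g\<^sub>j\<close> over a list of digits \<open>g\<^sub>j\<close>, in nested form. Induction
  on the list peels off \<open>g\<^sub>0\<close>, the only digit that is not hit by \<open>act c\<close>; \<open>horner_snoc\<close> relates
  it to the recursion of trajectories, which adds the highest power.\<close>

primrec horner :: "(int \<Rightarrow> int) \<Rightarrow> (int \<Rightarrow> int) list \<Rightarrow> int \<Rightarrow> int" where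
  "horner c [] = (\<lambda>_. 0)"
| "horner c (g # gs) = (\<lambda>n. g n + act c (horner c gs) n)"

lemma act_zero [simp]: "act c (\<lambda>_. 0) = (\<lambda>_. 0)"
  by (simp add: act_def fun_eq_iff)

lemma horner_snoc: "horner c (gs @ [g]) n = horner c gs n + (act c ^^ length gs) g n"
proof (induction gs arbitrary: n)
  case (Cons h gs)
  have "horner c (gs @ [g]) = (\<lambda>n. horner c gs n + (act c ^^ length gs) g n)"
    using Cons.IH by auto
  then show ?case by (simp add: act_add add.assoc)
qed simp

lemma horner_diff:
  "length fs = length gs \<Longrightarrow>
    horner c (map2 (\<lambda>f g n. f n - g n) fs gs) n = horner c fs n - horner c gs n"
proof (induction fs gs arbitrary: n rule: list_induct2)
  case (Cons f fs g gs)
  have "horner c (map2 (\<lambda>f g n. f n - g n) fs gs) = (\<lambda>n. horner c fs n - horner c gs n)"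
    using Cons.IH by auto
  then show ?case by (simp add: act_diff)
qed simp

lemma horner_scale: "horner c (map (\<lambda>g n. a * g n) gs) n = a * horner c gs n"
proof (induction gs arbitrary: n)
  case (Cons g gs)
  have "horner c (map (\<lambda>g n. a * g n) gs) = (\<lambda>n. a * horner c gs n)"
    using Cons.IH by auto
  then show ?case by (simp add: act_scale algebra_simps)
qed simp

lemma act_not_dvdE:
  assumes "\<not> p dvd act c x n"
  obtains i where "c i \<noteq> 0" "\<not> p dvd c i" "\<not> p dvd x (n + i)"
  using act_dvd[of c p x n] assms by (meson dvd_mult dvd_mult2)

lemma reach_le_act:
  assumes "reach_le p (- \<sigma>) c \<rho>" "reach_le p \<sigma> x b"
  shows "reach_le p \<sigma> (act c x) (b + \<rho>)"
  unfolding reach_le_def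
proof (intro allI impI)
  fix n assume "\<not> p dvd act c x n"
  then obtain i where "\<not> p dvd c i" "\<not> p dvd x (n + i)" by (rule act_not_dvdE)
  then have "- \<sigma> * i \<le> \<rho>" "\<sigma> * (n + i) \<le> b" using assms by (auto simp: reach_le_def)
  then show "\<sigma> * n \<le> b + \<rho>" by (simp add: algebra_simps)
qed

lemma reach_le_horner:
  assumes "reach_le p (- \<sigma>) c \<rho>" "0 \<le> \<rho>" "\<And>g. g \<in> set gs \<Longrightarrow> reach_le p \<sigma> g b"
  shows "reach_le p \<sigma> (horner c gs) (b + int (length gs) * \<rho>)"
  using assms(3)
proof (induction gs)
  case Nil
  then show ?case by (simp add: reach_le_def)
next
  case (Cons g gs)
  have g: "reach_le p \<sigma> g b" and IH: "reach_le p \<sigma> (horner c gs) (b + int (length gs) * \<rho>)"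
    using Cons by auto
  note A = reach_le_act[OF assms(1) IH]
  show ?case
    unfolding reach_le_def
  proof (intro allI impI)
    fix n assume "\<not> p dvd horner c (g # gs) n"
    then have "\<not> p dvd g n \<or> \<not> p dvd act c (horner c gs) n" by auto
    moreover have "0 \<le> int (length gs) * \<rho>" using assms(2) by simp
    moreover have "\<sigma> * n \<le> b" if "\<not> p dvd g n" using g that by (simp add: reach_le_def)
    moreover have "\<sigma> * n \<le> b + int (length gs) * \<rho> + \<rho>" if "\<not> p dvd act c (horner c gs) n"
      using A that by (simp add: reach_le_def)
    ultimately have "\<sigma> * n \<le> b + int (length gs) * \<rho> + \<rho>"
      using assms(2) by linarith
    then show "\<sigma> * n \<le> b + int (length (g # gs)) * \<rho>" by (simp add: algebra_simps)
  qed
qed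

lemma reach_attained:
  fixes \<sigma> :: int
  assumes "\<sigma> = 1 \<or> \<sigma> = -1" "reach_le p \<sigma> x b" "\<not> p dvd x n\<^sub>0"
  obtains s where "reach_le p \<sigma> x s" "\<not> p dvd x (\<sigma> * s)"
proof -
  have sq: "\<sigma> * (\<sigma> * n) = n" for n using assms(1) by auto
  define P where "P t \<longleftrightarrow> \<not> p dvd x (\<sigma> * (b - int t))" for t :: nat
  have ex: "P (nat (b - \<sigma> * n))" if "\<not> p dvd x n" for n
    using assms(2) that by (auto simp: P_def reach_le_def sq)
  define t where "t = (LEAST t. P t)"
  have "P t" unfolding t_def using ex[OF assms(3)] by (rule LeastI)
  moreover have "reach_le p \<sigma> x (b - int t)"
    unfolding reach_le_def
  proof (intro allI impI)
    fix n assume n: "\<not> p dvd x n"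
    have "t \<le> nat (b - \<sigma> * n)" unfolding t_def using ex[OF n] by (rule Least_le)
    moreover have "\<sigma> * n \<le> b" using assms(2) n by (simp add: reach_le_def)
    ultimately show "\<sigma> * n \<le> b - int t" by linarith
  qed
  ultimately show ?thesis using that[of "b - int t"] by (simp add: P_def)
qed

text \<open>Modulo \<open>p\<close>, the leading coefficient of a product is the product of the leading coefficients:
  only the extreme coefficient of \<open>c\<close> can bring the extreme entry of \<open>x\<close> to the position
  \<open>\<sigma> * (s + \<rho>)\<close>.\<close>

lemma act_extreme:
  fixes p \<sigma> :: int
  assumes p: "prime p" and sigma: "\<sigma> = 1 \<or> \<sigma> = -1" and fin: "finite {i. c i \<noteq> 0}"
    and c: "reach_le p (- \<sigma>) c \<rho>" "\<not> p dvd c (- \<sigma> * \<rho>)"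
    and x: "reach_le p \<sigma> x s" "\<not> p dvd x (\<sigma> * s)"
  shows "\<not> p dvd act c x (\<sigma> * (s + \<rho>))"
proof -
  have sq: "\<sigma> * (\<sigma> * n) = n" for n using sigma by auto
  let ?n = "\<sigma> * (s + \<rho>)" and ?I = "{i. c i \<noteq> 0}" and ?j = "- \<sigma> * \<rho>"
  have j: "?j \<in> ?I" using c(2) by auto
  have "p dvd c i * x (?n + i)" if "i \<in> ?I - {?j}" for i
  proof (rule ccontr)
    assume "\<not> p dvd c i * x (?n + i)"
    then have "\<not> p dvd c i" "\<not> p dvd x (?n + i)" by auto
    then have "- \<sigma> * i \<le> \<rho>" "\<sigma> * (?n + i) \<le> s" using c(1) x(1) by (auto simp: reach_le_def)
    then have "\<rho> = - \<sigma> * i" by (simp add: distrib_left sq)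
    then have "i = ?j" by (simp add: sq)
    then show False using that by simp
  qed
  then have "p dvd (\<Sum>i\<in>?I - {?j}. c i * x (?n + i))" by (rule dvd_sum)
  moreover have "?n + ?j = \<sigma> * s" by (simp add: algebra_simps)
  then have "\<not> p dvd c ?j * x (?n + ?j)" using c(2) x(2) p by (simp add: prime_dvd_mult_iff)
  moreover have "act c x ?n = c ?j * x (?n + ?j) + (\<Sum>i\<in>?I - {?j}. c i * x (?n + i))"
    unfolding act_def using sum.remove[OF fin j] .
  ultimately show ?thesis by (simp add: dvd_add_left_iff)
qed

text \<open>The speeds \<open>a\<close> to the right and \<open>b\<close> to the left. A positive speed is attained by a unit
  coefficient. A zero speed need not be: the truncation at \<open>0\<close> means that the digits themselves,
  which enter at every step at the same place, keep the end of the support where it is.\<close>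

definition speeds :: "int \<Rightarrow> (int \<Rightarrow> int) \<Rightarrow> int \<Rightarrow> int \<Rightarrow> bool" where
  "speeds p c a b \<longleftrightarrow> 0 \<le> a \<and> 0 \<le> b \<and> reach_le p (-1) c a \<and> reach_le p 1 c b \<and>
     (a > 0 \<longrightarrow> \<not> p dvd c (- a)) \<and> (b > 0 \<longrightarrow> \<not> p dvd c b)"

text \<open>Let \<open>t\<close> be the tail of the expansion, and write \<open>S t\<close> for \<open>act c t\<close>, so that \<open>f + S t\<close>
  vanishes modulo \<open>p\<close> with \<open>f\<close> supported on the window \<open>{0..<a + b}\<close>. If \<open>t\<close> were nonzero modulo
  \<open>p\<close>, then the extreme entries of \<open>S t\<close> would have to lie in the window. When both speeds are
  positive this is impossible because \<open>S t\<close> is wider than \<open>t\<close> by \<open>a + b\<close>. When exactly one speed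
  is zero, \<open>t\<close> cannot cross that end of the window, and \<open>S\<close> moves the other end of \<open>t\<close> out of
  the window on the opposite side. When both are zero, the window is empty and \<open>t\<close> cannot leave
  it. So \<open>t\<close> vanishes, hence also \<open>f\<close>.\<close>

lemma horner_injective_mod_prime:
  fixes p :: int
  assumes p: "prime p" and fin: "finite {i. c i \<noteq> 0}" and sp: "speeds p c a b"
    and win: "\<And>g n. g \<in> set gs \<Longrightarrow> n \<notin> {0..<a + b} \<Longrightarrow> p dvd g n"
    and zero: "\<And>n. p dvd horner c gs n"
  shows "g \<in> set gs \<Longrightarrow> p dvd g n"
  using win zero
proof (induction gs arbitrary: g n)
  case (Cons f gs)
  note ab = sp[unfolded speeds_def]
  define t where "t = horner c gs"
  have up: "reach_le p 1 g (a + b - 1)" and low: "reach_le p (- 1) g 0" if "g \<in> set (f # gs)" for g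
    using Cons.prems(2)[OF that] unfolding reach_le_def by force+
  have t_up: "reach_le p 1 t (a + b - 1 + int (length gs) * a)"
    unfolding t_def by (rule reach_le_horner) (use ab up in auto)
  have t_low: "reach_le p (- 1) t (0 + int (length gs) * b)"
    unfolding t_def by (rule reach_le_horner) (use ab low in auto)
  have f: "\<not> p dvd f n" if "\<not> p dvd act c t n" for n
    using Cons.prems(3)[of n] that by (auto simp: t_def dvd_add_right_iff)
  have "p dvd t n" for n
  proof (rule ccontr)
    assume n: "\<not> p dvd t n"
    \<comment> \<open>\<open>s\<close> is the right end of the support of \<open>t\<close> modulo \<open>p\<close>, and \<open>- r\<close> is the left end\<close>
    obtain s where s: "reach_le p 1 t s" "\<not> p dvd t (1 * s)"
      using reach_attained[OF _ t_up n] by blast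
    obtain r where r: "reach_le p (- 1) t r" "\<not> p dvd t (- 1 * r)"
      using reach_attained[OF _ t_low n] by blast
    have "- r \<le> s" using s(1) r(2) by (simp add: reach_le_def)
    have A: "s + a \<le> a + b - 1" if "a > 0"
    proof -
      have "\<not> p dvd act c t (1 * (s + a))"
        by (rule act_extreme) (use p fin ab that s in auto)
      then show ?thesis using f up[of f] by (auto simp: reach_le_def)
    qed
    have B: "r + b \<le> 0" if "b > 0"
    proof -
      have "\<not> p dvd act c t (- 1 * (r + b))"
        by (rule act_extreme) (use p fin ab that r in auto)
      then show ?thesis using f low[of f] by (fastforce simp: reach_le_def)
    qed
    consider "a > 0" "b > 0" | "a = 0" | "b = 0" using ab by fastforce
    then show False
    proof cases
      case 1
      then show False using A B \<open>- r \<le> s\<close> by linarith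
    next
      case 2
      then have "- r \<le> b - 1" using t_up r(2) by (simp add: reach_le_def)
      moreover have "- s \<le> 0" if "b = 0" using t_low s(2) that by (simp add: reach_le_def)
      moreover have "s \<le> b - 1" using t_up s(2) 2 by (simp add: reach_le_def)
      ultimately show False using B ab by linarith
    next
      case 3
      then have "- s \<le> 0" using t_low s(2) by (simp add: reach_le_def)
      moreover have "s \<le> - 1" if "a = 0" using t_up s(2) that 3 by (simp add: reach_le_def)
      ultimately show False using A 3 ab by linarith
    qed
  qed
  then have t: "\<And>n. p dvd horner c gs n" by (simp add: t_def)
  have "p dvd f n" for n
  proof -
    have "p dvd act c t n" by (rule act_dvd) (simp add: \<open>\<And>n. p dvd t n\<close>)
    then show ?thesis using Cons.prems(3)[of n] by (simp add: t_def dvd_add_left_iff)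
  qed
  then show ?case using Cons.IH[OF _ _ t] Cons.prems(1,2) by auto
qed simp

text \<open>By the case of a prime, all digits are divisible by \<open>p\<close>; dividing them by \<open>p\<close> divides the sum
  by \<open>p\<close> and lowers the exponent.\<close>

lemma horner_injective_mod_prime_power:
  fixes p :: int
  assumes p: "prime p" and fin: "finite {i. c i \<noteq> 0}" and sp: "speeds p c a b"
    and win: "\<And>g n. g \<in> set gs \<Longrightarrow> n \<notin> {0..<a + b} \<Longrightarrow> p ^ k dvd g n"
    and zero: "\<And>n. p ^ k dvd horner c gs n"
  shows "g \<in> set gs \<Longrightarrow> p ^ k dvd g n"
  using win zero
proof (induction k arbitrary: gs g n)
  case (Suc k)
  have p0: "p \<noteq> 0" using p by auto
  have dvd: "p dvd g n" if "g \<in> set gs" for g n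
  proof (rule horner_injective_mod_prime[OF p fin sp _ _ that])
    have "p dvd p ^ Suc k" by simp
    then show "p dvd horner c gs n" "g' \<in> set gs \<Longrightarrow> n \<notin> {0..<a + b} \<Longrightarrow> p dvd g' n" for g' n
      using Suc.prems(2,3) by (blast intro: dvd_trans)+
  qed
  define gs' where "gs' = map (\<lambda>g n. g n div p) gs"
  have "map (\<lambda>g n. p * g n) gs' = gs"
    unfolding gs'_def map_map by (rule map_idI) (simp add: dvd o_def)
  then have "horner c gs n = p * horner c gs' n" for n using horner_scale[of c p gs' n] by simp
  then have z: "p ^ k dvd horner c gs' n" for n using Suc.prems(3)[of n] p0 by simp
  have div: "p ^ k dvd g n div p \<longleftrightarrow> p ^ Suc k dvd g n" if "g \<in> set gs" for g n
    using dvd[OF that, of n] p0 by (metis dvd_mult_div_cancel dvd_mult_cancel_left power_Suc)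
  have "p ^ k dvd g' n" if "g' \<in> set gs'" "n \<notin> {0..<a + b}" for g' n
    using that Suc.prems(2) div by (auto simp: gs'_def)
  then have "p ^ k dvd g' n" if "g' \<in> set gs'" for g' n
    using Suc.IH[OF that] z by blast
  moreover have "(\<lambda>n. g n div p) \<in> set gs'" using Suc.prems(1) by (auto simp: gs'_def)
  ultimately have "p ^ k dvd g n div p" by blast
  then show ?case using div Suc.prems(1) by blast
qed simp

lemma horner_in_trajectory:
  assumes q: "q > 0" and S: "is_CA_with_coeffs q S c" and F: "F \<subseteq> carrier (fin_seq_group q)"
    and "set gs \<subseteq> F"
  shows "(\<lambda>n. horner c gs n mod int q) \<in> trajectory (fin_seq_group q) S F (length gs)"
  using assms(4)
proof (induction gs rule: rev_induct)
  case Nil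
  then show ?case by (simp add: one_fin_seq_group)
next
  case (snoc g gs)
  have g: "g \<in> F" using snoc.prems by simp
  have "horner c (gs @ [g]) n mod int q = (horner c gs n mod int q + (S ^^ length gs) g n) mod int q" for n
  proof -
    have "[(S ^^ length gs) g n = (act c ^^ length gs) g n] (mod int q)"
      by (rule CA_funpow_cong[OF q S]) (use g F in auto)
    then show ?thesis unfolding cong_def horner_snoc by (metis mod_add_eq mod_mod_trivial)
  qed
  then have "(\<lambda>n. horner c (gs @ [g]) n mod int q) =
      (\<lambda>n. horner c gs n mod int q) \<otimes>\<^bsub>fin_seq_group q\<^esub> (S ^^ length gs) g"
    by (simp add: mult_fin_seq_group)
  moreover have "set gs \<subseteq> F" using snoc.prems by simp
  ultimately show ?case using snoc.IH g by (auto simp: set_mult_def)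
qed

section \<open>Counting sequences with prescribed supports\<close>

lemma card_sequences_on:
  assumes q: "q > 0" and I: "finite I"
  shows "card {y \<in> carrier (fin_seq_group q). \<forall>n. n \<notin> I \<longrightarrow> y n = 0} = q ^ card I" (is "card ?Y = _")
proof -
  have "bij_betw (\<lambda>y. restrict y I) ?Y (I \<rightarrow>\<^sub>E {0..<int q})"
  proof (rule bij_betw_byWitness[where f' = "\<lambda>w n. if n \<in> I then w n else 0"])
    show "(\<lambda>w n. if n \<in> I then w n else 0) ` (I \<rightarrow>\<^sub>E {0..<int q}) \<subseteq> ?Y"
      using q I by (auto simp: carrier_fin_seq_group PiE_iff)
  qed (use q in \<open>auto simp: carrier_fin_seq_group fun_eq_iff PiE_iff extensional_def\<close>)
  then have "card ?Y = card (I \<rightarrow>\<^sub>E {0..<int q})" by (rule bij_betw_same_card)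
  then show ?thesis using I by (simp add: card_PiE)
qed

context coprime_moduli
begin

lemma q_dvd_M: "i \<in> {1..h} \<Longrightarrow> int (q i) dvd int M"
  using cong_M_iff[of "int M" 0] by (simp add: cong_0_iff)

text \<open>The Chinese remainder isomorphism maps the set \<open>X\<close> onto a product of sets of sequences with
  prescribed supports, one for each modulus.\<close>

lemma card_box:
  assumes I: "\<And>i. i \<in> {1..h} \<Longrightarrow> finite (I i)"
  defines "X \<equiv> {x \<in> carrier (fin_seq_group M). \<forall>i\<in>{1..h}. \<forall>n. n \<notin> I i \<longrightarrow> int (q i) dvd x n}"
  shows "card X = (\<Prod>i=1..h. q i ^ card (I i))"
proof -
  define Y where "Y i = {y \<in> carrier (fin_seq_group (q i)). \<forall>n. n \<notin> I i \<longrightarrow> y n = 0}" for i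
  have bij: "bij_betw (crt_map h q) (carrier (fin_seq_group M))
      (carrier (product_group {1..h} (\<lambda>i. fin_seq_group (q i))))"
    using crt_map_iso by (simp add: iso_def)
  have mem: "crt_map h q x \<in> PiE {1..h} Y \<longleftrightarrow> x \<in> X" if x: "x \<in> carrier (fin_seq_group M)" for x
  proof -
    have "crt_map h q x \<in> carrier (product_group {1..h} (\<lambda>i. fin_seq_group (q i)))"
      using bij x by (auto simp: bij_betw_def)
    then show ?thesis using x by (auto simp: X_def Y_def PiE_iff crt_map_def dvd_eq_mod_eq_0)
  qed
  have "crt_map h q ` X = PiE {1..h} Y"
  proof
    show "crt_map h q ` X \<subseteq> PiE {1..h} Y" using mem by (auto simp: X_def)
    show "PiE {1..h} Y \<subseteq> crt_map h q ` X"
    proof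
      fix w assume w: "w \<in> PiE {1..h} Y"
      then have "w \<in> crt_map h q ` carrier (fin_seq_group M)"
        using bij by (auto simp: bij_betw_def Y_def PiE_iff)
      then show "w \<in> crt_map h q ` X" using mem w by blast
    qed
  qed
  moreover have "inj_on (crt_map h q) X"
    using bij by (auto simp: bij_betw_def X_def intro: inj_on_subset)
  ultimately have "card X = card (PiE {1..h} Y)" by (metis card_image)
  also have "\<dots> = (\<Prod>i=1..h. card (Y i))" by (simp add: card_PiE)
  also have "\<dots> = (\<Prod>i=1..h. q i ^ card (I i))"
    unfolding Y_def by (intro prod.cong refl card_sequences_on q_pos I)
  finally show ?thesis .
qed

end

section \<open>Restriction to the factors\<close>

context coprime_moduli
begin

lemma factor_embedding_cong:
  assumes "i \<in> {1..h}" "y \<in> carrier (fin_seq_group (q i))"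
  shows "factor_embedding h q i y n mod int (q i) = y n"
  using fun_cong[OF fun_cong[OF crt_map_factor_embedding(2)[OF assms], of i], of n] assms(1)
  by (simp add: crt_map_def)

lemma CA_factor_subgroup:
  assumes S: "is_CA_with_coeffs M S c" and i: "i \<in> {1..h}"
  shows "S ` factor_subgroup h q i \<subseteq> factor_subgroup h q i"
proof
  fix z assume "z \<in> S ` factor_subgroup h q i"
  then obtain x where x: "x \<in> carrier (fin_seq_group M)" "z = S x"
    and dvd: "\<And>j n. j \<in> {1..h} \<Longrightarrow> j \<noteq> i \<Longrightarrow> int (q j) dvd x n"
    by (auto simp: factor_subgroup_eq[OF i])
  have "z \<in> carrier (fin_seq_group M)"
    using CA_hom[OF M_pos S] x by (auto simp: hom_def)
  moreover have "int (q j) dvd z n" if j: "j \<in> {1..h}" "j \<noteq> i" for j n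
  proof -
    have "z = linear_CA M c x" using S x by (simp add: is_CA_with_coeffs_def)
    moreover have "int (q j) dvd act c x n" by (rule act_dvd) (simp add: dvd[OF j])
    ultimately show ?thesis
      using dvd_mod_iff[OF q_dvd_M[OF j(1)]] by (simp add: linear_CA_eq_act)
  qed
  ultimately show "z \<in> factor_subgroup h q i" by (simp add: factor_subgroup_eq[OF i])
qed

text \<open>The embedding of \<open>y\<close> is congruent to \<open>y\<close> modulo \<open>q i\<close>, so applying \<open>S\<close> to it and reading the
  result modulo \<open>q i\<close> amounts to reducing the coefficients.\<close>

lemma CA_factor_restriction:
  assumes S: "is_CA_with_coeffs M S c" and i: "i \<in> {1..h}"
  shows "is_CA_with_coeffs (q i) (factor_restriction h q i S) (\<lambda>n. c n mod int (q i))"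
proof -
  let ?d = "\<lambda>n. c n mod int (q i)"
  have c: "c \<in> carrier (fin_seq_group M)" using S by (simp add: is_CA_with_coeffs_def)
  then have fin: "finite {n. c n \<noteq> 0}" using carrier_fin_seq_group[OF M_pos] by blast
  have fin': "finite {n. ?d n \<noteq> 0}" by (rule finite_subset[OF _ fin]) auto
  have "?d \<in> carrier (fin_seq_group (q i))"
    using fin' q_pos[OF i] by (simp add: carrier_fin_seq_group)
  moreover have "factor_restriction h q i S y = linear_CA (q i) ?d y"
    if y: "y \<in> carrier (fin_seq_group (q i))" for y
  proof -
    define e where "e = factor_embedding h q i y"
    have e: "e \<in> carrier (fin_seq_group M)" "e \<in> factor_subgroup h q i"
      using crt_map_factor_embedding(1)[OF i y] y by (auto simp: e_def factor_subgroup_def)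
    then have "S e \<in> factor_subgroup h q i" using CA_factor_subgroup[OF S i] by blast
    then obtain z where z: "z \<in> carrier (fin_seq_group (q i))" "S e = factor_embedding h q i z"
      by (auto simp: factor_subgroup_def)
    then have "factor_restriction h q i S y = z"
      using inj_on_factor_embedding[OF i] by (simp add: factor_restriction_def flip: e_def)
    moreover have "z n = act ?d y n mod int (q i)" for n
    proof -
      have "z n = S e n mod int (q i)" using factor_embedding_cong[OF i z(1)] z(2) by simp
      also have "\<dots> = act c e n mod int M mod int (q i)"
        using S e by (simp add: is_CA_with_coeffs_def linear_CA_eq_act)
      also have "\<dots> = act c e n mod int (q i)" using q_dvd_M[OF i] by (rule mod_mod_cancel)
      also have "\<dots> = act c y n mod int (q i)"
        using act_cong[of e y "int (q i)" c n] factor_embedding_cong[OF i y]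
        by (metis cong_def e_def mod_mod_trivial)
      also have "\<dots> = act ?d y n mod int (q i)"
        using act_cong_coeffs[OF fin fin', of "int (q i)" y n] by (simp add: cong_def)
      finally show ?thesis .
    qed
    ultimately show ?thesis by (simp add: linear_CA_eq_act fun_eq_iff)
  qed
  ultimately show ?thesis by (simp add: is_CA_with_coeffs_def)
qed

end

text \<open>Coprimality to \<open>p ^ k\<close> is coprimality to \<open>p\<close>, so the set \<open>D\<close> of the degree consists of the
  positions of the units modulo \<open>p\<close>, and the three cases in the definition of the degree are the
  three sign patterns of \<open>max 0 (- min D) + max 0 (max D)\<close>. Empty \<open>D\<close> means speed zero in both
  directions.\<close>

lemma degree_speeds:
  fixes p k :: nat
  assumes p: "prime p" "k > 0" and S: "is_CA_with_coeffs (p ^ k) S (\<lambda>n. c n mod int (p ^ k))"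
    and fin: "finite {i. c i \<noteq> 0}"
  obtains a b where "speeds (int p) c a b" "CA_degree (p ^ k) S = a + b"
proof -
  have q: "p ^ k > 0" using p by (simp add: prime_gt_0_nat)
  define D where "D = {i. \<not> int p dvd c i}"
  have coeffs: "CA_coeffs (p ^ k) S = (\<lambda>n. c n mod int (p ^ k))"
    unfolding CA_coeffs_def by (rule the_equality) (use S is_CA_with_coeffs_unique[OF q] in auto)
  have "gcd (c i mod int (p ^ k)) (int (p ^ k)) = 1 \<longleftrightarrow> \<not> int p dvd c i" for i
  proof -
    have "gcd (c i mod int (p ^ k)) (int (p ^ k)) = gcd (c i) (int p ^ k)"
      by (simp add: gcd.commute flip: gcd_red_int)
    moreover have "gcd (c i) (int p ^ k) = 1 \<longleftrightarrow> coprime (c i) (int p)"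
      using p(2) by (simp add: coprime_iff_gcd_eq_1[symmetric])
    moreover have "coprime (c i) (int p) \<longleftrightarrow> \<not> int p dvd c i"
    proof
      assume "coprime (c i) (int p)"
      moreover have "\<not> int p dvd 1" using p(1) not_prime_unit by force
      ultimately show "\<not> int p dvd c i" using coprime_common_divisor[of "c i" "int p" "int p"] by auto
    next
      assume "\<not> int p dvd c i"
      then show "coprime (c i) (int p)"
        using p(1) prime_imp_coprime[of "int p" "c i"] by (simp add: coprime_commute)
    qed
    ultimately show ?thesis by simp
  qed
  then have D: "{i. gcd (CA_coeffs (p ^ k) S i) (int (p ^ k)) = 1} = D" by (simp add: coeffs D_def)
  have finD: "finite D" by (rule finite_subset[OF _ fin]) (auto simp: D_def)
  show ?thesis
  proof (cases "D = {}")
    case True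
    then have "speeds (int p) c 0 0" by (auto simp: speeds_def reach_le_def D_def)
    then show ?thesis using that[of 0 0] True D by (simp add: CA_degree_def)
  next
    case False
    define l r where "l = Min D" and "r = Max D"
    have lr: "l \<in> D" "r \<in> D" "\<And>i. i \<in> D \<Longrightarrow> l \<le> i \<and> i \<le> r"
      using finD False by (auto simp: l_def r_def)
    have "speeds (int p) c (max 0 (- l)) (max 0 r)"
    proof -
      have "- 1 * i \<le> max 0 (- l)" "1 * i \<le> max 0 r" if "\<not> int p dvd c i" for i
        using lr(3)[of i] that by (auto simp: D_def)
      then show ?thesis using lr(1,2) by (auto simp: speeds_def reach_le_def D_def max_def)
    qed
    moreover have "CA_degree (p ^ k) S = max 0 (- l) + max 0 r"
      unfolding CA_degree_def D Let_def l_def[symmetric] r_def[symmetric]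
      using False lr(3)[OF lr(1)] by auto
    ultimately show ?thesis using that by blast
  qed
qed

section \<open>The entropy formula\<close>

context coprime_moduli
begin

text \<open>With \<open>F\<close> the set of sequences that modulo each \<open>q i\<close> are supported on the window
  \<open>{0..<a i + b i}\<close>, distinct lists of digits from \<open>F\<close> have distinct Horner sums modulo \<open>M\<close>: if
  two sums agree, then the list of differences has sum zero modulo every \<open>q i\<close>, and its entries
  are supported on the windows modulo every \<open>q i\<close>, so they vanish modulo \<open>M\<close>.\<close>

lemma trajectory_lower_bound:
  assumes S: "is_CA_with_coeffs M S c"
    and p: "\<And>i. i \<in> {1..h} \<Longrightarrow> prime (p i)" and q: "\<And>i. i \<in> {1..h} \<Longrightarrow> q i = p i ^ k i"
    and sp: "\<And>i. i \<in> {1..h} \<Longrightarrow> speeds (int (p i)) c (a i) (b i)"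
  obtains F where "F \<subseteq> carrier (fin_seq_group M)" "F \<noteq> {}" "finite F"
    "\<And>n. (\<Prod>i=1..h. q i ^ nat (a i + b i)) ^ n \<le> card (trajectory (fin_seq_group M) S F n)"
proof -
  interpret G: comm_group "fin_seq_group M" by (rule comm_group_fin_seq_group)
  note carr = carrier_fin_seq_group[OF M_pos]
  define F where "F = {x \<in> carrier (fin_seq_group M).
    \<forall>i\<in>{1..h}. \<forall>n. n \<notin> {0..<a i + b i} \<longrightarrow> int (q i) dvd x n}"
  have F: "F \<subseteq> carrier (fin_seq_group M)" by (auto simp: F_def)
  have card_F: "card F = (\<Prod>i=1..h. q i ^ nat (a i + b i))"
    unfolding F_def by (subst card_box) auto
  have "card F > 0" unfolding card_F using q_pos by (intro prod_pos) auto
  then have fin_F: "finite F" "F \<noteq> {}" by (auto simp: card_gt_0_iff)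
  have fin_c: "finite {i. c i \<noteq> 0}"
    using S carr by (auto simp: is_CA_with_coeffs_def)
  have "card F ^ n \<le> card (trajectory (fin_seq_group M) S F n)" for n
  proof -
    define \<Phi> where "\<Phi> gs = (\<lambda>n. horner c gs n mod int M)" for gs
    let ?L = "{gs. set gs \<subseteq> F \<and> length gs = n}"
    have "inj_on \<Phi> ?L"
    proof (rule inj_onI)
      fix fs gs assume fs: "fs \<in> ?L" and gs: "gs \<in> ?L" and eq: "\<Phi> fs = \<Phi> gs"
      define ds where "ds = map2 (\<lambda>f g n. f n - g n) fs gs"
      have "horner c fs n mod int M = horner c gs n mod int M" for n
        using fun_cong[OF eq, of n] by (simp add: \<Phi>_def)
      then have "int M dvd horner c ds n" for n
        using horner_diff[of fs gs c n] fs gs by (simp add: ds_def mod_eq_dvd_iff)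
      then have zero: "int (q i) dvd horner c ds n" if "i \<in> {1..h}" for i n
        using q_dvd_M[OF that] dvd_trans by blast
      have win: "int (q i) dvd d n" if i: "i \<in> {1..h}" and d: "d \<in> set ds" and n: "n \<notin> {0..<a i + b i}"
        for i d n
      proof -
        obtain f g where fg: "(f, g) \<in> set (zip fs gs)" and "d = (\<lambda>n. f n - g n)"
          using d by (auto simp: ds_def)
        moreover have "f \<in> F" "g \<in> F"
          using set_zip_leftD[OF fg] set_zip_rightD[OF fg] fs gs by auto
        ultimately have "d n = f n - g n" "int (q i) dvd f n" "int (q i) dvd g n"
          using i n by (auto simp: F_def)
        then show ?thesis by simp
      qed
      have ds: "int (q i) dvd d n" if i: "i \<in> {1..h}" and d: "d \<in> set ds" for i d n
      proof -
        have "int (p i) ^ k i dvd d n"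
          by (rule horner_injective_mod_prime_power[OF _ fin_c sp[OF i] _ _ d])
            (use p[OF i] win[OF i] zero[OF i] q[OF i] in auto)
        then show ?thesis using q[OF i] by simp
      qed
      show "fs = gs"
      proof (rule nth_equalityI)
        show "length fs = length gs" using fs gs by simp
        fix j assume j: "j < length fs"
        then have "fs ! j \<in> set fs" "gs ! j \<in> set gs" using fs gs by simp_all
        then have "fs ! j \<in> F" "gs ! j \<in> F" using fs gs by blast+
        then have mem: "fs ! j \<in> carrier (fin_seq_group M)" "gs ! j \<in> carrier (fin_seq_group M)"
          using F by blast+
        have "j < length ds" and "ds ! j = (\<lambda>n. (fs ! j) n - (gs ! j) n)"
          using j fs gs by (simp_all add: ds_def)
        then have "(\<lambda>n. (fs ! j) n - (gs ! j) n) \<in> set ds"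
          using nth_mem by metis
        then have "[(fs ! j) n = (gs ! j) n] (mod int (q i))" if "i \<in> {1..h}" for i n
          unfolding cong_iff_dvd_diff using ds[OF that] by blast
        then have "[(fs ! j) n = (gs ! j) n] (mod int M)" for n
          unfolding cong_M_iff by blast
        moreover have "x n mod int M = x n" if "x \<in> carrier (fin_seq_group M)" for x n
          by (rule mod_pos_pos_trivial) (use that[unfolded carr] in blast)+
        ultimately have "(fs ! j) n = (gs ! j) n" for n
          unfolding cong_def using mem by metis
        then show "fs ! j = gs ! j" by blast
      qed
    qed
    then have "card F ^ n = card (\<Phi> ` ?L)"
      by (simp add: card_image card_lists_length_eq fin_F)
    also have "\<dots> \<le> card (trajectory (fin_seq_group M) S F n)"
      using horner_in_trajectory[OF M_pos S F]
      by (intro card_mono G.finite_trajectory fin_F) (auto simp: \<Phi>_def)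
    finally show ?thesis .
  qed
  then show ?thesis using that F fin_F card_F by simp
qed

text \<open>Modulo \<open>q i\<close>, the decay to the right at speed \<open>a i\<close> and to the left at speed \<open>b i\<close> confines
  the \<open>n\<close>-th trajectory to an interval that grows by \<open>a i + b i\<close> cells per step.\<close>

lemma trajectory_upper_bound:
  assumes S: "is_CA_with_coeffs M S c"
    and q: "\<And>i. i \<in> {1..h} \<Longrightarrow> q i = p i ^ k i"
    and sp: "\<And>i. i \<in> {1..h} \<Longrightarrow> speeds (int (p i)) c (a i) (b i)"
    and F: "F \<subseteq> carrier (fin_seq_group M)" "finite F"
  obtains C where
    "\<And>n. card (trajectory (fin_seq_group M) S F n) \<le> (\<Prod>i=1..h. q i ^ (n * nat (a i + b i) + C i))"
proof -
  interpret G: comm_group "fin_seq_group M" by (rule comm_group_fin_seq_group)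
  note carr = carrier_fin_seq_group[OF M_pos]
  define W where "W = {i. c i \<noteq> 0} \<union> (\<Union>f\<in>F. {n. f n \<noteq> 0})"
  define N where "N = Max (insert 0 (abs ` W))"
  have "finite W"
    using S F carr by (auto simp: W_def is_CA_with_coeffs_def)
  then have N: "0 \<le> N" "\<And>n. n \<in> W \<Longrightarrow> \<bar>n\<bar> \<le> N" by (auto simp: N_def)
  \<comment> \<open>\<open>N\<close> bounds the initial supports, and it serves as block length for the decay, whose profile
    has \<open>k i\<close> blocks; so \<open>B i\<close> is the constant overhang at each end\<close>
  define B where "B i = N + N * int (k i)" for i
  have B: "0 \<le> B i" for i using N(1) by (simp add: B_def)
  have "card (trajectory (fin_seq_group M) S F n) \<le>
      (\<Prod>i=1..h. q i ^ (n * nat (a i + b i) + nat (2 * B i + 1)))" for n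
  proof -
    define I where "I i = {- (int n * b i + B i)..int n * a i + B i}" for i
    define X where "X = {x \<in> carrier (fin_seq_group M). \<forall>i\<in>{1..h}. \<forall>n. n \<notin> I i \<longrightarrow> int (q i) dvd x n}"
    have card_I: "card (I i) = n * nat (a i + b i) + nat (2 * B i + 1)" if "i \<in> {1..h}" for i
    proof -
      have "card (I i) = nat (int n * (a i + b i) + (2 * B i + 1))"
        by (simp add: I_def algebra_simps)
      then show ?thesis using sp[OF that] B[of i] by (simp add: speeds_def nat_add_distrib nat_mult_distrib)
    qed
    have "card X = (\<Prod>i=1..h. q i ^ card (I i))"
      unfolding X_def by (rule card_box) (simp add: I_def)
    also have "\<dots> = (\<Prod>i=1..h. q i ^ (n * nat (a i + b i) + nat (2 * B i + 1)))"
      by (intro prod.cong refl) (simp add: card_I)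
    finally have card_X: "card X = \<dots>" .
    moreover have "card X > 0" unfolding card_X using q_pos by (intro prod_pos) auto
    then have "finite X" by (simp add: card_gt_0_iff)
    moreover have "trajectory (fin_seq_group M) S F n \<subseteq> X"
    proof
      fix x assume x: "x \<in> trajectory (fin_seq_group M) S F n"
      have "int (q i) dvd x j" if i: "i \<in> {1..h}" and j: "j \<notin> I i" for i j
      proof -
        note s = sp[OF i, unfolded speeds_def]
        have dec: "decays (int (p i)) (k i) N \<sigma> x (N + int n * \<rho>)"
          if "\<sigma> = 1 \<and> \<rho> = a i \<or> \<sigma> = -1 \<and> \<rho> = b i" for \<sigma> \<rho>
        proof (rule decays_trajectory[OF M_pos S _ _ _ N(1) _ F(1) _ N(1) x])
          show "int (p i) ^ k i dvd int M" using q_dvd_M[OF i] q[OF i] by simp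
          show "reach_le (int (p i)) (- \<sigma>) c \<rho>" "0 \<le> \<rho>" using that s by auto
          show "- \<sigma> * i \<le> N" if "c i \<noteq> 0" for i
            using N(2)[of i] that \<open>\<sigma> = 1 \<and> _ \<or> _\<close> by (auto simp: W_def)
          show "\<sigma> * n \<le> N" if "f \<in> F" "f n \<noteq> 0" for f n
          proof -
            have "n \<in> W" using that by (auto simp: W_def)
            then show ?thesis using N(2)[of n] \<open>\<sigma> = 1 \<and> _ \<or> _\<close> by auto
          qed
        qed
        have "j > int n * a i + B i \<or> - j > int n * b i + B i" using j by (auto simp: I_def)
        then have "int (p i) ^ k i dvd x j"
          using decays_last[OF dec[of 1 "a i"] N(1), of j] decays_last[OF dec[of "-1" "b i"] N(1), of j]
          by (auto simp: B_def algebra_simps)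
        then show ?thesis using q[OF i] by simp
      qed
      then show "x \<in> X"
        using x G.trajectory_subset_carrier[OF CA_hom[OF M_pos S] F(1)] by (auto simp: X_def)
    qed
    ultimately show ?thesis by (metis card_mono)
  qed
  then show ?thesis using that[of "\<lambda>i. nat (2 * B i + 1)"] by blast
qed

lemma CA_entropy:
  assumes S: "is_CA_with_coeffs M S c"
    and p: "\<And>i. i \<in> {1..h} \<Longrightarrow> prime (p i)" and q: "\<And>i. i \<in> {1..h} \<Longrightarrow> q i = p i ^ k i"
    and sp: "\<And>i. i \<in> {1..h} \<Longrightarrow> speeds (int (p i)) c (a i) (b i)"
  shows "alg_entropy (fin_seq_group M) S = ereal (\<Sum>i=1..h. real_of_int (a i + b i) * ln (real (q i)))"
proof -
  interpret G: comm_group "fin_seq_group M" by (rule comm_group_fin_seq_group)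
  define E where "E = (\<Sum>i=1..h. real_of_int (a i + b i) * ln (real (q i)))"
  have ln_prod: "ln (real (\<Prod>i=1..h. q i ^ e i)) = (\<Sum>i=1..h. real (e i) * ln (real (q i)))" for e
  proof -
    have "ln (real (\<Prod>i=1..h. q i ^ e i)) = (\<Sum>i=1..h. ln (real (q i ^ e i)))"
      unfolding of_nat_prod by (rule ln_prod) (use q_pos in auto)
    also have "\<dots> = (\<Sum>i=1..h. real (e i) * ln (real (q i)))"
      by (intro sum.cong refl) (use q_pos in \<open>simp add: ln_realpow\<close>)
    finally show ?thesis .
  qed
  have real_nat: "real (nat (a i + b i)) = real_of_int (a i + b i)" if "i \<in> {1..h}" for i
    using sp[OF that] by (simp add: speeds_def)
  note lim = G.entropy_limit[OF CA_hom[OF M_pos S]]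
  have upper: "alg_entropy_wrt (fin_seq_group M) S F \<le> E"
    if F: "F \<subseteq> carrier (fin_seq_group M)" "F \<noteq> {}" "finite F" for F
  proof -
    obtain C where C: "\<And>n. card (trajectory (fin_seq_group M) S F n) \<le>
        (\<Prod>i=1..h. q i ^ (n * nat (a i + b i) + C i))"
      using trajectory_upper_bound[OF S q sp F(1,3)] by blast
    define D where "D = (\<Sum>i=1..h. real (C i) * ln (real (q i)))"
    have bound: "ln (real (card (trajectory (fin_seq_group M) S F n))) / real n \<le> E + D / real n"
      if n: "n \<ge> 1" for n
    proof -
      have "card (trajectory (fin_seq_group M) S F n) > 0"
        using G.trajectory_nonempty G.finite_trajectory F by (simp add: card_gt_0_iff)
      then have "ln (real (card (trajectory (fin_seq_group M) S F n))) \<le>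
          ln (real (\<Prod>i=1..h. q i ^ (n * nat (a i + b i) + C i)))"
        using C[of n] by (intro ln_mono) (simp_all only: of_nat_0_less_iff of_nat_le_iff)
      also have "\<dots> = (\<Sum>i=1..h. real n * (real_of_int (a i + b i) * ln (real (q i))) + real (C i) * ln (real (q i)))"
        unfolding ln_prod by (intro sum.cong refl) (simp only: of_nat_add of_nat_mult real_nat, simp add: algebra_simps)
      also have "\<dots> = real n * E + D"
        by (simp add: E_def D_def sum.distrib sum_distrib_left)
      finally show ?thesis using n by (simp add: field_simps)
    qed
    have "(\<lambda>n. E + D / real n) \<longlonglongrightarrow> E + 0"
      by (intro tendsto_add tendsto_const lim_const_over_n)
    then have "alg_entropy_wrt (fin_seq_group M) S F \<le> E + 0"
      by (rule LIMSEQ_le[OF lim[OF F]]) (use bound in blast)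
    then show ?thesis by simp
  qed
  obtain F where F: "F \<subseteq> carrier (fin_seq_group M)" "F \<noteq> {}" "finite F"
    and low: "\<And>n. (\<Prod>i=1..h. q i ^ nat (a i + b i)) ^ n \<le> card (trajectory (fin_seq_group M) S F n)"
    using trajectory_lower_bound[OF S p q sp] by blast
  have "E \<le> alg_entropy_wrt (fin_seq_group M) S F"
  proof (rule LIMSEQ_le_const[OF lim[OF F]], intro exI[of _ 1] allI impI)
    fix n :: nat assume n: "1 \<le> n"
    let ?P = "\<Prod>i=1..h. q i ^ nat (a i + b i)"
    have pos: "?P > 0" using q_pos by (intro prod_pos) auto
    have "E = ln (real ?P)"
      unfolding ln_prod E_def by (intro sum.cong refl) (simp add: real_nat)
    then have "real n * E = ln (real (?P ^ n))" using pos by (simp add: ln_realpow del: of_nat_prod)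
    also have "\<dots> \<le> ln (real (card (trajectory (fin_seq_group M) S F n)))"
    proof -
      have "0 < ?P ^ n" using pos by (rule zero_less_power)
      then have "0 < real (?P ^ n)" "real (?P ^ n) \<le> real (card (trajectory (fin_seq_group M) S F n))"
        using low[of n] by (simp_all only: of_nat_0_less_iff of_nat_le_iff)
      then show ?thesis by (intro ln_mono) auto
    qed
    finally show "E \<le> ln (real (card (trajectory (fin_seq_group M) S F n))) / real n"
      using n by (simp add: field_simps)
  qed
  then have "ereal E \<le> alg_entropy (fin_seq_group M) S"
    unfolding alg_entropy_def using F by (intro SUP_upper2[of F]) auto
  moreover have "alg_entropy (fin_seq_group M) S \<le> ereal E"
    unfolding alg_entropy_def using upper by (intro SUP_least) auto
  ultimately show ?thesis by (simp add: E_def)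
qed

end

theorem theorem1p12:
  fixes m h :: nat and p k :: "nat \<Rightarrow> nat" and S :: "(int \<Rightarrow> int) \<Rightarrow> (int \<Rightarrow> int)"
  assumes "m > 0"
    and "\<And>i. i \<in> {1..h} \<Longrightarrow> prime (p i)"
    and "\<And>i. i \<in> {1..h} \<Longrightarrow> k i > 0"
    and "inj_on p {1..h}"
    and "m = (\<Prod>i=1..h. p i ^ k i)"
    and "finitary_linear_CA m S"
  shows "let q = (\<lambda>i. p i ^ k i) in
    (\<forall>i\<in>{1..h}. S ` factor_subgroup h q i \<subseteq> factor_subgroup h q i \<and>
        finitary_linear_CA (q i) (factor_restriction h q i S)) \<and>
    alg_entropy (fin_seq_group m) S =
      ereal (\<Sum>i=1..h. real_of_int (CA_degree (q i) (factor_restriction h q i S)) * ln (real (q i)))"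
proof -
  define q where "q = (\<lambda>i. p i ^ k i)"
  interpret coprime_moduli h q
  proof
    show "q i > 0" if "i \<in> {1..h}" for i
      using assms(2)[OF that] by (simp add: q_def prime_gt_0_nat)
    show "coprime (q i) (q j)" if "i \<in> {1..h}" "j \<in> {1..h}" "i \<noteq> j" for i j
    proof -
      have "p i \<noteq> p j" using assms(4) that by (auto dest: inj_onD)
      then have "coprime (p i) (p j)" using assms(2) that by (simp add: primes_coprime)
      then show ?thesis by (simp add: q_def)
    qed
  qed
  have m: "m = M" using assms(5) by (simp add: q_def)
  obtain c where c: "is_CA_with_coeffs M S c"
    using assms(6) by (auto simp: m finitary_linear_CA_def)
  then have fin: "finite {i. c i \<noteq> 0}"
    using carrier_fin_seq_group[OF M_pos] by (auto simp: is_CA_with_coeffs_def)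
  have "\<exists>a b. speeds (int (p i)) c a b \<and> CA_degree (q i) (factor_restriction h q i S) = a + b"
    if i: "i \<in> {1..h}" for i
    using degree_speeds[OF assms(2)[OF i] assms(3)[OF i] CA_factor_restriction[OF c i, unfolded q_def] fin]
    unfolding q_def by metis
  then obtain a b where sp: "\<And>i. i \<in> {1..h} \<Longrightarrow> speeds (int (p i)) c (a i) (b i)"
    and deg: "\<And>i. i \<in> {1..h} \<Longrightarrow> CA_degree (q i) (factor_restriction h q i S) = a i + b i"
    by metis
  have "alg_entropy (fin_seq_group m) S =
      ereal (\<Sum>i=1..h. real_of_int (CA_degree (q i) (factor_restriction h q i S)) * ln (real (q i)))"
    using CA_entropy[OF c assms(2) q_def[THEN fun_cong] sp] by (simp add: m deg)
  then show ?thesis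
    unfolding Let_def q_def[symmetric] finitary_linear_CA_def
    using CA_factor_subgroup[OF c] CA_factor_restriction[OF c] by blast
qed

end
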